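(* Let $I$ be an ideal in a polynomial ring $R=\mathsf{k}[x_1,\dots,x_n]$ over a field $\mathsf{k}$ with $q\ge 1$ minimal square-free monomial generators. The following hold: (1) if $q\ge 3$, $r\ge 2$, and $\psi_I(h(r,q))\notin I^r$, then $I^{(r)}\neq I^r$; (2) if $q\le 2$, then $I^{(r)}=I^r$ for all $r\ge 1$; (3) if $q=3$, then $I^{(2)}=I^2+(\psi_I(h(2,3)))$; (4) $I^{(2)}=\big(\psi_I(f_X) : \emptyset\neq X\subseteq[q]\big)$; (5) $\mathrm{sdefect}(2,I)\le 2^q-1-q-\binom{q}{2}$.
   Context: Let $[q]=\{1,\dots,q\}$ and $S_{[q]}=\mathsf{k}[y_A : \emptyset\neq A\subseteq[q]]$. For $i\in[q]$ set $\epsilon_i=\prod_{A\subseteq[q],\, i\in A}y_A\in S_{[q]}$. If $m_1,\dots,m_q$ are the minimal monomial generators of $I$, then $\psi_I\colon S_{[q]}\to R$ is the $\mathsf{k}$-algebra homomorphism with $\psi_I(y_A)$ equal to the product of all variables $x_k$ ($k\in[n]$) such that for every $j\in[q]$: $x_k\mid m_j \iff j\in A$ (empty product $=1$). For $r\ge 2$, $q\ge 3$: $h(r,q)=y_{[q]}\Big(\prod_{\emptyset\neq A\subseteq[q]}y_A\Big)\epsilon_1^{\,r-2}$. For $\emptyset\neq X\subseteq[q]$: $$f_X=\prod_{X\subseteq A}y_A^2\ \prod_{X\cap A\neq\emptyset,\ X\cap A^{c}\neq\emptyset}y_A,$$ where $A$ ranges over nonempty subsets of $[q]$ and $A^c=[q]\smallsetminus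 A$. The $r$-th symbolic power of $I$ is $I^{(r)}=\bigcap_{P\in\mathrm{Min}(I)}(I^rR_P\cap R)$, where $\mathrm{Min}(I)$ is the set of minimal primes of $I$ (for square-free monomial $I$, $I^{(r)}=\bigcap_{P\in\mathrm{Min}(I)}P^r$). $\mathrm{sdefect}(r,I)=\mu(I^{(r)}/I^r)$, where $\mu$ is the minimal number of generators as an $R$-module. *)

theory Defs
  imports
    "HOL-Algebra.Module"
    "HOL-Algebra.Ideal_Product"
    "HOL-Decision_Procs.Algebra_Aux"
    "HOL-Computational_Algebra.Polynomial_Factorial"
    "HOL-Computational_Algebra.Squarefree"
    "HOL-Library.Poly_Mapping"
    "HOL-Library.Extended_Nat"
begin

section \<open>Ideals, minimal primes and symbolic powers\<close>

text \<open>Ring types are turned into ring records with full carrier by \<^const>\<open>cring_class_ops\<close>, so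
  that ideals, prime ideals and products of ideals are those of \<^theory>\<open>HOL-Algebra.Ideal_Product\<close>.\<close>

abbreviation ideal_gen :: "'a::comm_ring_1 set \<Rightarrow> 'a set"
  where "ideal_gen S \<equiv> Idl\<^bsub>cring_class_ops\<^esub> S"

abbreviation ideal_sum :: "'a::comm_ring_1 set \<Rightarrow> 'a set \<Rightarrow> 'a set"
  where "ideal_sum I J \<equiv> I <+>\<^bsub>cring_class_ops\<^esub> J"

abbreviation ideal_power :: "'a::comm_ring_1 set \<Rightarrow> nat \<Rightarrow> 'a set"
  where "ideal_power I r \<equiv> I [^]\<^bsub>ideals_set cring_class_ops\<^esub> r"

definition minimal_primes :: "'a::comm_ring_1 set \<Rightarrow> 'a set set"
  where "minimal_primes I =
    {P. primeideal P cring_class_ops \<and> I \<subseteq> P \<and>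
        (\<forall>Q. primeideal Q cring_class_ops \<and> I \<subseteq> Q \<and> Q \<subseteq> P \<longrightarrow> Q = P)}"

text \<open>For a prime ideal \<open>P\<close> of a domain, the localization at \<open>P\<close> as a subring of the fraction field.\<close>

definition localization_at :: "'a::idom set \<Rightarrow> 'a fract ring"
  where "localization_at P = cring_class_ops\<lparr>carrier := {Fract a s | a s. s \<notin> P}\<rparr>"

text \<open>The set under the intersection is the contraction to the base ring of the extension of
  \<open>I\<^sup>r\<close> to the localization at \<open>P\<close>. If \<open>I\<close> is the unit ideal there are no minimal primes and the
  intersection is the whole ring.\<close>

definition symbolic_power :: "'a::idom set \<Rightarrow> nat \<Rightarrow> 'a set"
  where "symbolic_power I r =
    (\<Inter>P\<in>minimal_primes I.
      {f. to_fract f \<in> Idl\<^bsub>localization_at P\<^esub> (to_fract ` ideal_power I r)})"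

section \<open>Number of generators and the symbolic defect\<close>

text \<open>The quotient of an ideal \<open>M\<close> by an ideal \<open>N \<subseteq> M\<close>, as a module over the base ring, consisting
  of the cosets \<open>N + f\<close>. The record type also has the fields \<open>mult\<close> and \<open>one\<close>, which play no role
  in the module structure.\<close>

definition quotient_module :: "'a::comm_ring_1 set \<Rightarrow> 'a set \<Rightarrow> ('a, 'a set) module"
  where "quotient_module M N =
    \<lparr>carrier = (\<lambda>f. N +>\<^bsub>cring_class_ops\<^esub> f) ` M,
     monoid.mult = undefined, one = undefined,
     zero = N,
     add = (\<lambda>X Y. X <+>\<^bsub>cring_class_ops\<^esub> Y),
     module.smult = (\<lambda>c X. \<Union>f\<in>X. N +>\<^bsub>cring_class_ops\<^esub> (c * f))\<rparr>"

definition generates_module ::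
    "('a, 'b) ring_scheme \<Rightarrow> ('a, 'c, 'd) module_scheme \<Rightarrow> 'c set \<Rightarrow> bool"
  where "generates_module R M G \<longleftrightarrow>
    G \<subseteq> carrier M \<and> \<Inter>{H. submodule H R M \<and> G \<subseteq> H} = carrier M"

text \<open>The value is \<open>\<infinity>\<close> if there is no finite generating set.\<close>

definition min_num_generators ::
    "('a, 'b) ring_scheme \<Rightarrow> ('a, 'c, 'd) module_scheme \<Rightarrow> enat"
  where "min_num_generators R M =
    (INF G\<in>{G. finite G \<and> generates_module R M G}. enat (card G))"

definition sdefect :: "nat \<Rightarrow> 'a::idom set \<Rightarrow> enat"
  where "sdefect r I =
    min_num_generators cring_class_ops (quotient_module (symbolic_power I r) (ideal_power I r))"

section \<open>Polynomial rings\<close>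

text \<open>The polynomial ring over \<open>'k\<close> with variables indexed by \<open>'v\<close>: finitely supported families of
  coefficients, indexed by exponent vectors, with convolution as product.\<close>

type_synonym ('v, 'k) mpoly = "('v \<Rightarrow>\<^sub>0 nat) \<Rightarrow>\<^sub>0 'k"

definition Var :: "'v \<Rightarrow> ('v, 'k::field) mpoly"
  where "Var v = Poly_Mapping.single (Poly_Mapping.single v 1) 1"

definition Const :: "'k::field \<Rightarrow> ('v, 'k) mpoly"
  where "Const c = Poly_Mapping.single 0 c"

definition is_monomial :: "('v, 'k::field) mpoly \<Rightarrow> bool"
  where "is_monomial u \<longleftrightarrow> (\<exists>e. u = Poly_Mapping.single e 1)"

text \<open>The algebra homomorphism that maps each variable \<open>v\<close> to \<open>g v\<close>.\<close>

definition subst_hom :: "('v \<Rightarrow> ('w, 'k::field) mpoly) \<Rightarrow> ('v, 'k) mpoly \<Rightarrow> ('w, 'k) mpoly"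
  where "subst_hom g p =
    (\<Sum>e\<in>Poly_Mapping.keys p. Const (Poly_Mapping.lookup p e) *
      (\<Prod>v\<in>Poly_Mapping.keys e. g v ^ Poly_Mapping.lookup e v))"

definition minimal_squarefree_generators ::
    "('v, 'k::field) mpoly set \<Rightarrow> nat \<Rightarrow> (nat \<Rightarrow> ('v, 'k) mpoly) \<Rightarrow> bool"
  where "minimal_squarefree_generators I q m \<longleftrightarrow>
    (\<forall>j\<in>{1..q}. is_monomial (m j) \<and> squarefree (m j)) \<and>
    I = ideal_gen (m ` {1..q}) \<and>
    (\<forall>J. J \<subset> {1..q} \<longrightarrow> ideal_gen (m ` J) \<noteq> I)"

section \<open>The map \<open>\<psi>\<close> and the elements \<open>\<epsilon>\<close>, \<open>h\<close> and \<open>f\<close>\<close>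

text \<open>The ring \<open>S\<close> with variables \<open>y\<^sub>A\<close>, \<open>\<emptyset> \<noteq> A \<subseteq> {1..q}\<close>, is regarded as a subring of the
  polynomial ring with variables \<open>Var A\<close> for all \<open>A :: nat set\<close>; the elements below lie in \<open>S\<close>.\<close>

definition nonempty_subsets :: "nat \<Rightarrow> nat set set"
  where "nonempty_subsets q = {A. A \<noteq> {} \<and> A \<subseteq> {1..q}}"

definition psi :: "nat \<Rightarrow> (nat \<Rightarrow> ('n::finite, 'k::field) mpoly) \<Rightarrow>
    (nat set, 'k) mpoly \<Rightarrow> ('n, 'k) mpoly"
  where "psi q m = subst_hom (\<lambda>A. \<Prod>k\<in>{k. \<forall>j\<in>{1..q}. Var k dvd m j \<longleftrightarrow> j \<in> A}. Var k)"

definition eps :: "nat \<Rightarrow> nat \<Rightarrow> (nat set, 'k::field) mpoly"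
  where "eps q i = (\<Prod>A\<in>{A \<in> nonempty_subsets q. i \<in> A}. Var A)"

definition h_elem :: "nat \<Rightarrow> nat \<Rightarrow> (nat set, 'k::field) mpoly"
  where "h_elem r q = Var {1..q} * (\<Prod>A\<in>nonempty_subsets q. Var A) * eps q 1 ^ (r - 2)"

definition f_elem :: "nat \<Rightarrow> nat set \<Rightarrow> (nat set, 'k::field) mpoly"
  where "f_elem q X =
    (\<Prod>A\<in>{A \<in> nonempty_subsets q. X \<subseteq> A}. Var A ^ 2) *
    (\<Prod>A\<in>{A \<in> nonempty_subsets q. X \<inter> A \<noteq> {} \<and> X \<inter> ({1..q} - A) \<noteq> {}}. Var A)"

end

theory Submission
  imports Defs "HOL-Algebra.Subrings"
begin

text \<open>
  Everything is reduced to inequalities between exponent vectors. Write the generators as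
  \<open>m\<^sub>j = \<Prod>k\<in>S\<^sub>j. x\<^sub>k\<close>. A set \<open>C\<close> of variables that meets every \<open>S\<^sub>j\<close> is a cover, and \<open>vdeg C e\<close>
  is the degree of the monomial with exponent \<open>e\<close> in the variables of \<open>C\<close>. The minimal primes of
  \<open>I\<close> are the ideals generated by the variables of the minimal covers, and

  \<^item> \<open>I\<^bsup>(r)\<^esup>\<close> is spanned by the monomials whose exponent \<open>e\<close> satisfies \<open>r \<le> vdeg C e\<close> for every
    cover \<open>C\<close> (\<open>symbolic_power_edge_ideal\<close>).

  For the inclusion from left to right, the minimal \<open>C\<close>-degree of a product is the sum of the
  minimal \<open>C\<close>-degrees of its factors, because the polynomial ring is a domain; the elements of
  \<open>I\<^sup>r\<close> have \<open>C\<close>-degree at least \<open>r\<close>, and an element outside the prime of \<open>C\<close> has a term of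
  \<open>C\<close>-degree \<open>0\<close>. For the other inclusion, every variable of a minimal cover \<open>C\<close> becomes an element
  of \<open>I\<close> once it is multiplied by all variables outside \<open>C\<close>, and those are units at the prime of \<open>C\<close>.

  The map \<open>\<psi>\<close> reads off the incidence set \<open>{j. k \<in> S\<^sub>j}\<close> of each variable \<open>x\<^sub>k\<close>. Hence \<open>\<psi>(f\<^sub>X)\<close> has
  exponent \<open>2\<close> at \<open>k\<close> if \<open>X\<close> is contained in the incidence set of \<open>k\<close>, exponent \<open>1\<close> if \<open>X\<close>
  only meets it, and \<open>0\<close> otherwise. Such a monomial has degree at least \<open>2\<close> on every cover: either
  one variable of the cover counts twice, or two variables count once. Conversely, if \<open>x\<^sup>e\<close> has degree
  at least \<open>2\<close> on every cover, then it is divisible by \<open>\<psi>(f\<^sub>X)\<close> for the set \<open>X\<close> of those \<open>j\<close> for which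
  \<open>m\<^sub>j\<close> divides \<open>x\<^sup>e\<close>, as one sees by testing the degree on the complement of the support
  of \<open>e\<close>, possibly enlarged by one variable. This gives the generators of \<open>I\<^bsup>(2)\<^esup>\<close>.

  The generators with \<open>X = {i, j}\<close> (where \<open>i = j\<close> is possible) are the products \<open>m\<^sub>i m\<^sub>j\<close>, so modulo
  \<open>I\<^sup>2\<close> only the sets \<open>X\<close> with at least three elements remain. Their number is the bound for
  the symbolic defect, and for \<open>q = 3\<close> the only one is \<open>X = {1, 2, 3}\<close>, with \<open>\<psi>(f\<^sub>X) = \<psi>(h(2,3))\<close>.
  In general \<open>\<psi>(h(r,q)) = \<psi>(f\<^sub>X) m\<^sub>1\<^bsup>r - 2\<^esup>\<close> for \<open>X = {1..q}\<close>, which has degree at least \<open>r\<close> on every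
  cover and therefore lies in \<open>I\<^bsup>(r)\<^esup>\<close>.

  For two generators \<open>x\<^bsup>A\<^esup>\<close> and \<open>x\<^bsup>B\<^esup>\<close>, the covers with at most two elements already force divisibility
  by \<open>(x\<^bsup>A\<^esup>)\<^bsup>a\<^esup> (x\<^bsup>B\<^esup>)\<^bsup>r - a\<^esup>\<close>, where \<open>a\<close> is the least exponent on \<open>A - B\<close>, cut off at \<open>r\<close>.
\<close>

section \<open>Ideals of commutative rings\<close>

lemma ring_class: "ring (cring_class_ops :: 'a::comm_ring_1 ring)"
  using cring_class by (rule cring.axioms(1))

lemma ideal_class_iff:
  "ideal I (cring_class_ops :: 'a::comm_ring_1 ring) \<longleftrightarrow>
    0 \<in> I \<and> (\<forall>a\<in>I. \<forall>b\<in>I. a + b \<in> I) \<and> (\<forall>a\<in>I. \<forall>x. x * a \<in> I)"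
proof
  assume "ideal I (cring_class_ops :: 'a ring)"
  then interpret ideal I "cring_class_ops :: 'a ring" .
  show "0 \<in> I \<and> (\<forall>a\<in>I. \<forall>b\<in>I. a + b \<in> I) \<and> (\<forall>a\<in>I. \<forall>x. x * a \<in> I)"
    using zero_closed a_closed I_l_closed
    by (simp add: carrier_class class_simps)
next
  assume I: "0 \<in> I \<and> (\<forall>a\<in>I. \<forall>b\<in>I. a + b \<in> I) \<and> (\<forall>a\<in>I. \<forall>x. x * a \<in> I)"
  then have neg: "- a \<in> I" if "a \<in> I" for a
    using that by (metis mult_minus1)
  show "ideal I (cring_class_ops :: 'a ring)"
  proof (rule idealI)
    show "ring (cring_class_ops :: 'a ring)"
      by (rule ring_class)
    show "subgroup I (add_monoid (cring_class_ops :: 'a ring))"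
      using I neg uminus_class[where 'a = 'a]
      by (auto simp: subgroup_def carrier_class class_simps a_inv_def)
  qed (use I in \<open>auto simp: class_simps mult.commute\<close>)
qed

lemma primeideal_class_iff:
  "primeideal P (cring_class_ops :: 'a::comm_ring_1 ring) \<longleftrightarrow>
    ideal P cring_class_ops \<and> 1 \<notin> P \<and> (\<forall>a b. a * b \<in> P \<longrightarrow> a \<in> P \<or> b \<in> P)"
proof
  assume P: "primeideal P (cring_class_ops :: 'a ring)"
  interpret primeideal P "cring_class_ops :: 'a ring" by (rule P)
  show "ideal P cring_class_ops \<and> 1 \<notin> P \<and> (\<forall>a b. a * b \<in> P \<longrightarrow> a \<in> P \<or> b \<in> P)"
    using I_prime I_notcarr one_imp_carrier ideal_axioms
    by (auto simp: carrier_class class_simps)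
next
  assume P: "ideal P cring_class_ops \<and> 1 \<notin> P \<and> (\<forall>a b. a * b \<in> P \<longrightarrow> a \<in> P \<or> b \<in> P)"
  show "primeideal P (cring_class_ops :: 'a ring)"
    by (rule primeidealI) (use P carrier_class[of "1::'a"] in \<open>auto simp: class_simps cring_class\<close>)
qed

lemma ideal_mult_closed:
  "ideal I cring_class_ops \<Longrightarrow> a \<in> I \<Longrightarrow> x * a \<in> (I :: 'a::comm_ring_1 set)"
  by (simp add: ideal_class_iff)

lemma ideal_sum_closed:
  assumes "ideal I (cring_class_ops :: 'a::comm_ring_1 ring)" and "\<And>x. x \<in> A \<Longrightarrow> g x \<in> I"
  shows "sum g A \<in> I"
  using assms by (induction A rule: infinite_finite_induct) (auto simp: ideal_class_iff)

lemma ideal_gen_ideal: "ideal (ideal_gen S) (cring_class_ops :: 'a::comm_ring_1 ring)"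
  by (rule ring.genideal_ideal[OF ring_class]) (simp add: carrier_class subset_iff)

lemma ideal_gen_self: "S \<subseteq> ideal_gen (S :: 'a::comm_ring_1 set)"
  by (rule ring.genideal_self[OF ring_class]) (simp add: carrier_class subset_iff)

lemma ideal_genI: "x \<in> S \<Longrightarrow> x \<in> ideal_gen (S :: 'a::comm_ring_1 set)"
  using ideal_gen_self by blast

lemma ideal_sum_eq: "ideal_sum A B = {a + b | a b. a \<in> A \<and> b \<in> (B :: 'a::comm_ring_1 set)}"
  by (auto simp: set_add_def' class_simps)

lemma ideal_power_0: "ideal_power I 0 = (UNIV :: 'a::comm_ring_1 set)"
  by (simp add: nat_pow_def ideals_set_def cring_class_ops_def)

lemma ideal_power_Suc:
  "ideal_power I (Suc r) = ideal_prod cring_class_ops (ideal_power I r) (I :: 'a::comm_ring_1 set)"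
  by (simp add: nat_pow_def ideals_set_def)

lemma ideal_ideal_power:
  assumes "ideal I (cring_class_ops :: 'a::comm_ring_1 ring)"
  shows "ideal (ideal_power I r) cring_class_ops"
proof (induction r)
  case 0
  then show ?case unfolding ideal_power_0 by (simp add: ideal_class_iff)
next
  case (Suc r)
  then show ?case
    using ring.ideal_prod_is_ideal[OF ring_class Suc assms] unfolding ideal_power_Suc by simp
qed

lemma mult_mem_ideal_power_Suc:
  "x \<in> ideal_power I r \<Longrightarrow> y \<in> I \<Longrightarrow> x * y \<in> ideal_power I (Suc r)"
  for I :: "'a::comm_ring_1 set"
  using ideal_prod.prod[of x "ideal_power I r" y I cring_class_ops]
  unfolding ideal_power_Suc times_class .

lemma mult_power_mem_ideal_power:
  assumes "x \<in> ideal_power I r" and "y \<in> (I :: 'a::comm_ring_1 set)"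
  shows "x * y ^ n \<in> ideal_power I (r + n)"
proof (induction n)
  case (Suc n)
  then show ?case
    using mult_mem_ideal_power_Suc[OF Suc assms(2)] by (simp add: mult_ac)
qed (use assms(1) in simp)

lemma power_mem_ideal_power: "y \<in> (I :: 'a::comm_ring_1 set) \<Longrightarrow> y ^ n \<in> ideal_power I n"
  using mult_power_mem_ideal_power[of 1 I 0 y n] unfolding ideal_power_0 by simp

lemma ideal_sum_gen:
  assumes "ideal J (cring_class_ops :: 'a::comm_ring_1 ring)"
  shows "ideal_sum J (ideal_gen G) = ideal_gen (J \<union> G)"
proof
  have "J \<subseteq> ideal_gen (J \<union> G)" "G \<subseteq> ideal_gen (J \<union> G)"
    using ideal_gen_self[of "J \<union> G"] by auto
  moreover have "ideal_gen G \<subseteq> ideal_gen (J \<union> G)"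
    using calculation(2) by (rule ring.genideal_minimal[OF ring_class ideal_gen_ideal])
  moreover have "\<forall>a\<in>ideal_gen (J \<union> G). \<forall>b\<in>ideal_gen (J \<union> G). a + b \<in> ideal_gen (J \<union> G)"
    using ideal_gen_ideal[of "J \<union> G"] by (simp add: ideal_class_iff)
  ultimately show "ideal_sum J (ideal_gen G) \<subseteq> ideal_gen (J \<union> G)"
    unfolding ideal_sum_eq by blast
  have 0: "0 \<in> J" "0 \<in> ideal_gen G"
    using assms ideal_gen_ideal[of G] by (simp_all add: ideal_class_iff)
  have "J \<subseteq> ideal_sum J (ideal_gen G)"
    using 0(2) unfolding ideal_sum_eq by (smt (verit) add.right_neutral mem_Collect_eq subsetI)
  moreover have "G \<subseteq> ideal_sum J (ideal_gen G)"
    using 0(1) ideal_gen_self[of G] unfolding ideal_sum_eq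
    by (smt (verit) add_0 mem_Collect_eq subset_iff)
  ultimately show "ideal_gen (J \<union> G) \<subseteq> ideal_sum J (ideal_gen G)"
    by (intro ring.genideal_minimal[OF ring_class] ring.add_ideals[OF ring_class assms]
        ideal_gen_ideal) simp
qed

lemma mult_mem_ideal_power_2:
  assumes "x \<in> (I :: 'a::comm_ring_1 set)" and "y \<in> I"
  shows "x * y \<in> ideal_power I 2"
proof -
  have "x \<in> ideal_power I 1" using power_mem_ideal_power[OF assms(1), of 1] by simp
  from mult_mem_ideal_power_Suc[OF this assms(2)] show ?thesis by (simp add: numeral_2_eq_2)
qed

section \<open>Symbolic powers without localization\<close>

lemma localization_at_ring:
  fixes P :: "'a::idom set"
  assumes "primeideal P cring_class_ops"
  shows "ring (localization_at P)"
proof -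
  have P: "0 \<in> P" "1 \<notin> P" "\<And>a b. a * b \<in> P \<Longrightarrow> a \<in> P \<or> b \<in> P"
    using assms by (auto simp: primeideal_class_iff ideal_class_iff)
  have "subring {Fract a s | a s. s \<notin> P} (cring_class_ops :: 'a fract ring)"
  proof (rule ring.subringI[OF ring_class])
    show "\<one>\<^bsub>cring_class_ops\<^esub> \<in> {Fract a s | a s. s \<notin> P}"
      using P(2) by (auto simp: class_simps One_fract_def)
    show "\<ominus>\<^bsub>cring_class_ops\<^esub> h \<in> {Fract a s | a s. s \<notin> P}"
      if "h \<in> {Fract a s | a s. s \<notin> P}" for h
      using that by (fastforce simp: class_simps)
    fix g h assume "g \<in> {Fract a s | a s. s \<notin> P}" "h \<in> {Fract a s | a s. s \<notin> P}"
    then obtain a s b t where g: "g = Fract a s" "s \<notin> P" and h: "h = Fract b t" "t \<notin> P"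
      by auto
    have st: "s * t \<notin> P" "s \<noteq> 0" "t \<noteq> 0" using P g h by auto
    show "g \<otimes>\<^bsub>cring_class_ops\<^esub> h \<in> {Fract a s | a s. s \<notin> P}"
      using g h st by (auto simp: class_simps)
    show "g \<oplus>\<^bsub>cring_class_ops\<^esub> h \<in> {Fract a s | a s. s \<notin> P}"
      using g h st by (auto simp: class_simps)
  qed (auto simp: carrier_class)
  then show ?thesis
    unfolding localization_at_def by (rule ring.subring_is_ring[OF ring_class])
qed

lemma localization_at_simps:
  "carrier (localization_at P) = {Fract a s | a s. s \<notin> P}"
  "x \<otimes>\<^bsub>localization_at P\<^esub> y = x * y"
  "x \<oplus>\<^bsub>localization_at P\<^esub> y = x + y"
  "\<zero>\<^bsub>localization_at P\<^esub> = 0"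
  by (simp_all add: localization_at_def cring_class_ops_def)

text \<open>The elements of the extended ideal are the fractions \<open>g / s\<close> with \<open>g \<in> J\<close> and \<open>s \<notin> P\<close>: these
  fractions form an ideal of the localization, and each of them is a multiple of an element of \<open>J\<close>.\<close>

lemma mem_contraction_iff:
  fixes P :: "'a::idom set"
  assumes P: "primeideal P cring_class_ops" and J: "ideal J cring_class_ops"
  shows "to_fract f \<in> Idl\<^bsub>localization_at P\<^esub> (to_fract ` J) \<longleftrightarrow> (\<exists>s. s \<notin> P \<and> s * f \<in> J)"
proof
  let ?R = "localization_at P"
  have P': "0 \<in> P" "1 \<notin> P" "\<And>a b. a * b \<in> P \<Longrightarrow> a \<in> P \<or> b \<in> P"
    using P by (auto simp: primeideal_class_iff ideal_class_iff)
  have J': "0 \<in> J" "\<And>a b. a \<in> J \<Longrightarrow> b \<in> J \<Longrightarrow> a + b \<in> J" "\<And>a x. a \<in> J \<Longrightarrow> x * a \<in> J"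
    using J by (auto simp: ideal_class_iff)
  interpret R: ring ?R by (rule localization_at_ring[OF P])
  define K where "K = {Fract g s | g s. g \<in> J \<and> s \<notin> P}"
  have "ideal K ?R"
  proof (rule idealI[OF localization_at_ring[OF P]])
    show "subgroup K (add_monoid ?R)"
    proof (rule R.add.subgroupI)
      show "K \<subseteq> carrier ?R" by (auto simp: K_def localization_at_simps)
      show "K \<noteq> {}" using J' P' by (auto simp: K_def)
      show "x \<oplus>\<^bsub>?R\<^esub> y \<in> K" if xy: "x \<in> K" "y \<in> K" for x y
      proof -
        obtain g s h t where x: "x = Fract g s" "g \<in> J" "s \<notin> P"
          and y: "y = Fract h t" "h \<in> J" "t \<notin> P"
          using xy by (auto simp: K_def)
        have "s \<noteq> 0" "t \<noteq> 0" "s * t \<notin> P" using x y P' by auto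
        moreover have "g * t + h * s \<in> J"
          using J' x y by (metis mult.commute)
        ultimately show ?thesis
          using x y by (auto simp: K_def localization_at_simps)
      qed
      show "\<ominus>\<^bsub>?R\<^esub> x \<in> K" if x: "x \<in> K" for x
      proof -
        obtain g s where g: "x = Fract g s" "g \<in> J" "s \<notin> P"
          using x by (auto simp: K_def)
        have "\<ominus>\<^bsub>?R\<^esub> x = - x"
        proof (rule R.minus_equality)
          show "- x \<oplus>\<^bsub>?R\<^esub> x = \<zero>\<^bsub>?R\<^esub>" by (simp add: localization_at_simps)
        qed (use g in \<open>auto simp: localization_at_simps\<close>)
        moreover have "- g \<in> J" using J'(3)[OF g(2), of "-1"] by simp
        ultimately show ?thesis using g by (auto simp: K_def)
      qed
    qed
    show "x \<otimes>\<^bsub>?R\<^esub> a \<in> K" "a \<otimes>\<^bsub>?R\<^esub> x \<in> K" if ax: "a \<in> K" "x \<in> carrier ?R" for a x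
    proof -
      obtain g s h t where x: "x = Fract g s" "s \<notin> P" and a: "a = Fract h t" "h \<in> J" "t \<notin> P"
        using ax by (auto simp: K_def localization_at_simps)
      have "s * t \<notin> P" "g * h \<in> J" using x a P' J' by auto
      then show "x \<otimes>\<^bsub>?R\<^esub> a \<in> K" "a \<otimes>\<^bsub>?R\<^esub> x \<in> K"
        using x a by (auto simp: K_def localization_at_simps mult.commute)
    qed
  qed
  moreover have "to_fract ` J \<subseteq> K"
    using P' by (auto simp: K_def to_fract_def)
  ultimately have sub: "Idl\<^bsub>?R\<^esub> (to_fract ` J) \<subseteq> K"
    by (rule R.genideal_minimal)
  assume "to_fract f \<in> Idl\<^bsub>?R\<^esub> (to_fract ` J)"
  then obtain g s where gs: "Fract f 1 = Fract g s" "g \<in> J" "s \<notin> P"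
    using sub by (auto simp: K_def to_fract_def)
  then have "s \<noteq> 0" using P' by auto
  with gs have "s * f = g" by (simp add: eq_fract mult.commute)
  with gs show "\<exists>s. s \<notin> P \<and> s * f \<in> J" by auto
next
  let ?R = "localization_at P"
  assume "\<exists>s. s \<notin> P \<and> s * f \<in> J"
  then obtain s where s: "s \<notin> P" "s * f \<in> J" by auto
  then have "s \<noteq> 0" using P by (auto simp: primeideal_class_iff ideal_class_iff)
  then have eq: "to_fract f = Fract 1 s \<otimes>\<^bsub>?R\<^esub> to_fract (s * f)"
    by (simp add: localization_at_simps to_fract_def eq_fract mult.commute)
  have "Fract 1 s \<in> carrier ?R" using s by (auto simp: localization_at_simps)
  then have "to_fract f \<in> K" if "ideal K ?R" "to_fract ` J \<subseteq> K" for K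
    using ideal.I_l_closed[OF that(1), of "to_fract (s * f)"] s that(2) unfolding eq by blast
  then show "to_fract f \<in> Idl\<^bsub>?R\<^esub> (to_fract ` J)"
    by (auto simp: genideal_def)
qed

text \<open>This form of the definition needs no fractions, so that membership can be tested on terms of
  polynomials.\<close>

lemma symbolic_power_eq:
  fixes I :: "'a::idom set"
  assumes "ideal I cring_class_ops"
  shows "symbolic_power I r =
    {f. \<forall>P\<in>minimal_primes I. \<exists>s. s \<notin> P \<and> s * f \<in> ideal_power I r}"
proof -
  have "{f. to_fract f \<in> Idl\<^bsub>localization_at P\<^esub> (to_fract ` ideal_power I r)} =
      {f. \<exists>s. s \<notin> P \<and> s * f \<in> ideal_power I r}" if "P \<in> minimal_primes I" for P
  proof -
    have "primeideal P cring_class_ops" using that by (simp add: minimal_primes_def)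
    then show ?thesis
      by (simp only: mem_contraction_iff ideal_ideal_power[OF assms])
  qed
  then show ?thesis unfolding symbolic_power_def by blast
qed

section \<open>Generators of quotients\<close>

text \<open>The cosets of the elements of \<open>G\<close> generate \<open>M / N\<close>: the elements whose coset lies in a given
  submodule that contains these cosets form an ideal containing \<open>N\<close> and \<open>G\<close>. The module axioms for
  the quotient serve to show that its carrier is itself one of the submodules that are intersected.\<close>

lemma min_num_generators_quotient_le:
  fixes M N :: "'a::comm_ring_1 set"
  assumes M: "ideal M cring_class_ops" and N: "ideal N cring_class_ops"
    and NM: "N \<subseteq> M" and fin: "finite G" and gen: "M = ideal_gen (N \<union> G)"
  shows "min_num_generators cring_class_ops (quotient_module M N) \<le> enat (card G)"
proof -
  let ?Q = "quotient_module M N" and ?A = "cring_class_ops :: 'a ring"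
  define co where "co f = N +>\<^bsub>cring_class_ops\<^esub> f" for f
  have M': "0 \<in> M" "\<And>a b. a \<in> M \<Longrightarrow> b \<in> M \<Longrightarrow> a + b \<in> M" "\<And>a x. a \<in> M \<Longrightarrow> x * a \<in> M"
    using M by (auto simp: ideal_class_iff)
  have N': "0 \<in> N" "\<And>a b. a \<in> N \<Longrightarrow> b \<in> N \<Longrightarrow> a + b \<in> N" "\<And>a x. a \<in> N \<Longrightarrow> x * a \<in> N"
    using N by (auto simp: ideal_class_iff)
  have Nm: "- a \<in> N" if "a \<in> N" for a using N'(3)[OF that, of "-1"] by simp
  have Mm: "- a \<in> M" if "a \<in> M" for a using M'(3)[OF that, of "-1"] by simp
  have co: "co f = {n + f | n. n \<in> N}" for f
    by (auto simp: co_def a_r_coset_def' class_simps)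
  have mem: "g \<in> co f \<longleftrightarrow> g - f \<in> N" for f g
  proof
    assume "g - f \<in> N"
    moreover have "g = (g - f) + f" by simp
    ultimately show "g \<in> co f" unfolding co by blast
  qed (auto simp: co)
  have co_eq: "co f = co g" if "f - g \<in> N" for f g
  proof -
    have "h - f \<in> N \<longleftrightarrow> h - g \<in> N" for h
      using N'(2)[of "h - f" "f - g"] N'(2)[of "h - g" "- (f - g)"] Nm[OF that] that
      by (simp add: algebra_simps) blast
    then show ?thesis by (auto simp: mem)
  qed
  have N0: "N = co 0" unfolding co by simp
  have addc: "co f <+>\<^bsub>?A\<^esub> co g = co (f + g)" for f g
  proof (intro equalityI subsetI)
    fix x assume "x \<in> co f <+>\<^bsub>?A\<^esub> co g"
    then obtain a b where ab: "a \<in> co f" "b \<in> co g" "x = a + b" by (auto simp: ideal_sum_eq)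
    then have "x - (f + g) = (a - f) + (b - g)" by simp
    then show "x \<in> co (f + g)" using ab N'(2)[of "a - f" "b - g"] unfolding mem by (simp add: add_diff_add)
  next
    fix x assume "x \<in> co (f + g)"
    then have "x - g \<in> co f" "g \<in> co g" "x = (x - g) + g"
      using N' by (auto simp: mem algebra_simps)
    then show "x \<in> co f <+>\<^bsub>?A\<^esub> co g"
      unfolding ideal_sum_eq by (intro CollectI exI conjI)
  qed
  have smc: "(\<Union>g\<in>co f. N +>\<^bsub>cring_class_ops\<^esub> (c * g)) = co (c * f)" for c f
  proof -
    have "co (c * g) = co (c * f)" if "g \<in> co f" for g
      using that N'(3)[of "g - f" c] by (intro co_eq) (simp add: mem algebra_simps)
    moreover have "f \<in> co f" using N' by (simp add: mem)
    ultimately show ?thesis unfolding co_def[symmetric] by blast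
  qed
  have Q: "carrier ?Q = co ` M" "\<zero>\<^bsub>?Q\<^esub> = co 0"
    "\<And>f g. co f \<oplus>\<^bsub>?Q\<^esub> co g = co (f + g)" "\<And>c f. c \<odot>\<^bsub>?Q\<^esub> co f = co (c * f)"
    using N0 addc smc by (auto simp: quotient_module_def co_def[abs_def])
  have "abelian_group ?Q"
  proof (rule abelian_groupI)
    show "\<exists>y\<in>carrier ?Q. y \<oplus>\<^bsub>?Q\<^esub> x = \<zero>\<^bsub>?Q\<^esub>" if "x \<in> carrier ?Q" for x
    proof -
      obtain f where f: "f \<in> M" "x = co f" using \<open>x \<in> carrier ?Q\<close> Q by auto
      then have "co (- f) \<oplus>\<^bsub>?Q\<^esub> x = \<zero>\<^bsub>?Q\<^esub>" by (simp add: Q)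
      then show ?thesis using Mm f Q(1) by blast
    qed
  qed (use M' in \<open>auto simp: Q add_ac\<close>)
  then interpret Q: Module.module ?A ?Q
    by (intro Module.moduleI cring_class) (use M' in \<open>auto simp: Q class_simps distrib_left distrib_right mult.assoc\<close>)
  have GM: "G \<subseteq> M" using ideal_gen_self[of "N \<union> G"] gen by auto
  have "generates_module ?A ?Q (co ` G)"
    unfolding generates_module_def
  proof (intro conjI equalityI subsetI)
    fix x assume "x \<in> co ` G" then show "x \<in> carrier ?Q" using GM Q by auto
  next
    fix x assume "x \<in> \<Inter>{H. submodule H ?A ?Q \<and> co ` G \<subseteq> H}"
    moreover have "co ` G \<subseteq> carrier ?Q" using GM Q by auto
    ultimately show "x \<in> carrier ?Q" using Q.carrier_is_submodule by blast
  next
    fix x assume "x \<in> carrier ?Q"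
    then obtain f where f: "f \<in> M" "x = co f" using Q by auto
    have "x \<in> H" if H: "submodule H ?A ?Q" and GH: "co ` G \<subseteq> H" for H
    proof -
      interpret H: submodule H ?A ?Q by (rule H)
      define K where "K = {g. co g \<in> H}"
      have z: "co 0 \<in> H" using H.one_closed by (simp add: Q)
      have "ideal K ?A"
        unfolding ideal_class_iff K_def
        using z H.m_closed[of "co a" "co b" for a b] H.smult_closed[of c "co a" for a c]
        by (auto simp: Q carrier_class)
      moreover have "N \<union> G \<subseteq> K"
        using GH z co_eq[of n 0 for n] by (auto simp: K_def)
      ultimately have "M \<subseteq> K" using gen ring.genideal_minimal[OF ring_class] by blast
      then show "x \<in> H" using f by (auto simp: K_def)
    qed
    then show "x \<in> \<Inter>{H. submodule H ?A ?Q \<and> co ` G \<subseteq> H}" by blast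
  qed
  then have "min_num_generators ?A ?Q \<le> enat (card (co ` G))"
    unfolding min_num_generators_def using fin by (intro INF_lower) auto
  also have "\<dots> \<le> enat (card G)" using fin by (simp add: card_image_le)
  finally show ?thesis .
qed

section \<open>Monomial ideals\<close>

abbreviation monomial :: "('v \<Rightarrow>\<^sub>0 nat) \<Rightarrow> ('v, 'k::field) mpoly"
  where "monomial e \<equiv> Poly_Mapping.single e 1"

text \<open>For an upward closed set \<open>E\<close> of exponents, this is the ideal generated by the monomials with
  exponents in \<open>E\<close>.\<close>

definition mon_ideal :: "('v \<Rightarrow>\<^sub>0 nat) set \<Rightarrow> ('v, 'k::field) mpoly set"
  where "mon_ideal E = {f. Poly_Mapping.keys f \<subseteq> E}"

text \<open>Closure under addition is used instead of the order of the type of exponents, which is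
  lexicographic and does not express divisibility of monomials.\<close>

definition upclosed :: "('v \<Rightarrow>\<^sub>0 nat) set \<Rightarrow> bool"
  where "upclosed E \<longleftrightarrow> (\<forall>e\<in>E. \<forall>c. c + e \<in> E)"

lemma monom_add: "monomial (a + b) = (monomial a * monomial b :: ('v, 'k::field) mpoly)"
  by (simp add: mult_single)

lemma monom_sum: "monomial (sum g A) = (\<Prod>x\<in>A. monomial (g x) :: ('v, 'k::field) mpoly)"
  by (induction A rule: infinite_finite_induct) (simp_all add: monom_add)

lemma monom_mem_mon_ideal: "monomial e \<in> mon_ideal E \<longleftrightarrow> e \<in> E"
  by (simp add: mon_ideal_def)

lemma ideal_mon_ideal:
  assumes "upclosed E"
  shows "ideal (mon_ideal E :: ('v, 'k::field) mpoly set) cring_class_ops"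
proof -
  have "Poly_Mapping.keys (a + b) \<subseteq> E"
    if "Poly_Mapping.keys a \<subseteq> E" "Poly_Mapping.keys b \<subseteq> E" for a b :: "('v, 'k) mpoly"
    using that keys_add[of a b] by blast
  moreover have "Poly_Mapping.keys (x * a) \<subseteq> E"
    if "Poly_Mapping.keys a \<subseteq> E" for a x :: "('v, 'k) mpoly"
    using that keys_mult[of x a] assms by (fastforce simp: upclosed_def)
  ultimately show ?thesis by (auto simp: ideal_class_iff mon_ideal_def)
qed

lemma mpoly_eq_sum_terms:
  fixes f :: "('v, 'k::field) mpoly"
  shows "f = (\<Sum>e\<in>Poly_Mapping.keys f. Const (Poly_Mapping.lookup f e) * monomial e)"
  by (rule poly_mapping_eqI)
    (auto simp: Const_def mult_single lookup_sum lookup_single when_def sum.If_cases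
      in_keys_iff if_distrib cong: if_cong)

lemma mon_ideal_subset:
  fixes J :: "('v, 'k::field) mpoly set"
  assumes J: "ideal J cring_class_ops" and E: "\<And>e. e \<in> E \<Longrightarrow> monomial e \<in> J"
  shows "mon_ideal E \<subseteq> J"
proof
  fix f :: "('v, 'k) mpoly" assume f: "f \<in> mon_ideal E"
  have "(\<Sum>e\<in>Poly_Mapping.keys f. Const (Poly_Mapping.lookup f e) * monomial e) \<in> J"
    using f E J by (intro ideal_sum_closed[OF J]) (auto simp: mon_ideal_def ideal_class_iff)
  then show "f \<in> J" using mpoly_eq_sum_terms[of f] by simp
qed

lemma ideal_gen_monom:
  "ideal_gen (monomial ` G :: ('v, 'k::field) mpoly set) = mon_ideal {c + g | c g. g \<in> G}"
proof
  have "upclosed {c + g | c g. g \<in> G}"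
    by (auto simp: upclosed_def) (metis add.assoc)
  moreover have "monomial ` G \<subseteq> mon_ideal {c + g | c g. g \<in> G}"
    by (auto simp: monom_mem_mon_ideal) (metis add_0)
  ultimately show "ideal_gen (monomial ` G :: ('v, 'k) mpoly set) \<subseteq> mon_ideal {c + g | c g. g \<in> G}"
    by (intro ring.genideal_minimal[OF ring_class] ideal_mon_ideal)
  show "mon_ideal {c + g | c g. g \<in> G} \<subseteq> ideal_gen (monomial ` G :: ('v, 'k) mpoly set)"
  proof (rule mon_ideal_subset[OF ideal_gen_ideal])
    fix e assume "e \<in> {c + g | c g. g \<in> G}"
    then obtain c g where e: "e = c + g" "g \<in> G" by auto
    then have "monomial g \<in> ideal_gen (monomial ` G :: ('v, 'k) mpoly set)"
      by (intro ideal_genI imageI)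
    then show "monomial e \<in> ideal_gen (monomial ` G :: ('v, 'k) mpoly set)"
      unfolding e monom_add by (rule ideal_mult_closed[OF ideal_gen_ideal])
  qed
qed

text \<open>For an additive weight \<open>w\<close>, the lowest weight in a product is the sum of the lowest weights in the
  factors: the parts of lowest weight of \<open>s\<close> and \<open>f\<close> have a nonzero product, as the polynomial ring is
  a domain, and all other contributions to \<open>s * f\<close> have a larger weight.\<close>

lemma key_of_mult:
  fixes f s :: "('v::linorder, 'k::field) mpoly" and w :: "('v \<Rightarrow>\<^sub>0 nat) \<Rightarrow> nat"
  assumes w: "\<And>a b. w (a + b) = w a + w b"
    and a: "a \<in> Poly_Mapping.keys s" and b: "b \<in> Poly_Mapping.keys f"
  obtains c where "c \<in> Poly_Mapping.keys (s * f)" and "w c \<le> w a + w b"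
proof -
  define low where "low g = (MIN e\<in>Poly_Mapping.keys g. w e)" for g :: "('v, 'k) mpoly"
  define init where "init g = Poly_Mapping.mapp (\<lambda>e c. if w e = low g then c else 0) g"
    for g :: "('v, 'k) mpoly"
  have lookup_init: "Poly_Mapping.lookup (init g) e =
      (if w e = low g then Poly_Mapping.lookup g e else 0)" for g e
    by (auto simp: init_def lookup_mapp when_def in_keys_iff)
  have low_le: "low g \<le> w e" if "e \<in> Poly_Mapping.keys g" for g e
    using that by (simp add: low_def)
  have init_nz: "init g \<noteq> 0" if "e \<in> Poly_Mapping.keys g" for g e
  proof -
    have "low g \<in> w ` Poly_Mapping.keys g"
      unfolding low_def using that by (intro Min_in) auto
    then obtain d where "d \<in> Poly_Mapping.keys g" "low g = w d" by auto
    then have "Poly_Mapping.lookup (init g) d \<noteq> 0" by (simp add: lookup_init in_keys_iff)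
    then show ?thesis by auto
  qed
  have keys_init: "w e = low g" if "e \<in> Poly_Mapping.keys (init g)" for g e
    using that by (auto simp: in_keys_iff lookup_init split: if_splits)
  have keys_rest: "low g < w e" if "e \<in> Poly_Mapping.keys (g - init g)" for g e
    using that low_le[of e g]
    by (auto simp: in_keys_iff lookup_init lookup_minus split: if_splits)
  \<comment> \<open>A term of the product of the lowest parts survives in the whole product.\<close>
  have "init s * init f \<noteq> 0" using init_nz a b by simp
  then obtain c where c: "c \<in> Poly_Mapping.keys (init s * init f)"
    by (metis ex_in_conv keys_eq_empty)
  then have wc: "w c = low s + low f"
    using keys_mult[of "init s" "init f"] keys_init w by fastforce
  let ?r1 = "(s - init s) * f" and ?r2 = "init s * (f - init f)"
  have "w e > low s + low f" if "e \<in> Poly_Mapping.keys ?r1" for e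
    using keys_mult[of "s - init s" f] that keys_rest low_le w by (fastforce simp: add_less_le_mono)
  moreover have "w e > low s + low f" if "e \<in> Poly_Mapping.keys ?r2" for e
    using keys_mult[of "init s" "f - init f"] that keys_rest keys_init w
    by (fastforce simp: add_le_less_mono)
  ultimately have "Poly_Mapping.lookup ?r1 c = 0" "Poly_Mapping.lookup ?r2 c = 0"
    using wc by (metis in_keys_iff less_irrefl)+
  moreover have "s * f = init s * init f + ?r1 + ?r2" by (simp add: algebra_simps)
  ultimately have "c \<in> Poly_Mapping.keys (s * f)"
    using c by (simp add: in_keys_iff lookup_add)
  moreover have "w c \<le> w a + w b"
    using wc low_le[OF a] low_le[OF b] by simp
  ultimately show thesis by (rule that)
qed

section \<open>Symbolic powers of square-free monomial ideals\<close>

text \<open>Since there are finitely many variables, every function is an exponent vector.\<close>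

definition exp_of :: "('n::finite \<Rightarrow> nat) \<Rightarrow> 'n \<Rightarrow>\<^sub>0 nat"
  where "exp_of = Poly_Mapping.Abs_poly_mapping"

lemma lookup_exp_of [simp]: "Poly_Mapping.lookup (exp_of g) k = g k"
  by (simp add: exp_of_def)

lemma exp_eqI: "e = exp_of g" if "\<And>k. Poly_Mapping.lookup e k = g k"
  by (rule poly_mapping_eqI) (simp add: that)

text \<open>The right-hand side says that the monomial with exponent \<open>g\<close> divides the one with exponent \<open>e\<close>.\<close>

lemma exp_le_iff:
  fixes e g :: "'n::finite \<Rightarrow>\<^sub>0 nat"
  shows "(\<exists>c. e = c + g) \<longleftrightarrow> (\<forall>k. Poly_Mapping.lookup g k \<le> Poly_Mapping.lookup e k)"
proof
  assume "\<forall>k. Poly_Mapping.lookup g k \<le> Poly_Mapping.lookup e k"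
  then have "e = (e - g) + g" by (intro poly_mapping_eqI) (simp add: lookup_add lookup_minus)
  then show "\<exists>c. e = c + g" by blast
qed (auto simp: lookup_add)

abbreviation indic :: "'n::finite set \<Rightarrow> 'n \<Rightarrow>\<^sub>0 nat"
  where "indic S \<equiv> exp_of (\<lambda>k. of_bool (k \<in> S))"

definition vdeg :: "'n::finite set \<Rightarrow> ('n \<Rightarrow>\<^sub>0 nat) \<Rightarrow> nat"
  where "vdeg C e = (\<Sum>k\<in>C. Poly_Mapping.lookup e k)"

text \<open>A square-free monomial ideal as the edge ideal of a hypergraph on the variables.\<close>

definition edge_ideal :: "'n::finite set set \<Rightarrow> ('n, 'k::field) mpoly set"
  where "edge_ideal \<E> = ideal_gen ((\<lambda>S. monomial (indic S)) ` \<E>)"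

definition cover :: "'n set set \<Rightarrow> 'n set \<Rightarrow> bool"
  where "cover \<E> C \<longleftrightarrow> (\<forall>S\<in>\<E>. C \<inter> S \<noteq> {})"

text \<open>This is the ideal generated by the variables in \<open>C\<close>, in the form in which membership is a condition
  on degrees.\<close>

definition var_ideal :: "'n::finite set \<Rightarrow> ('n, 'k::field) mpoly set"
  where "var_ideal C = mon_ideal {e. vdeg C e \<ge> 1}"

lemma vdeg_add: "vdeg C (a + b) = vdeg C a + vdeg C b"
  by (simp add: vdeg_def lookup_add sum.distrib)

lemma vdeg_mono: "C \<subseteq> D \<Longrightarrow> vdeg C e \<le> vdeg D e"
  unfolding vdeg_def by (rule sum_mono2) auto

lemma vdeg_ge_1_iff: "vdeg C e \<ge> 1 \<longleftrightarrow> (\<exists>k\<in>C. Poly_Mapping.lookup e k \<noteq> 0)"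
proof -
  have "vdeg C e = 0 \<longleftrightarrow> (\<forall>k\<in>C. Poly_Mapping.lookup e k = 0)" by (simp add: vdeg_def)
  then show ?thesis by (auto simp: Suc_le_eq)
qed

lemma upclosed_vdeg: "upclosed {e. r \<le> vdeg C e}"
  by (auto simp: upclosed_def vdeg_add)

lemma Var_mem_var_ideal: "Var k \<in> var_ideal C \<longleftrightarrow> k \<in> C"
  unfolding var_ideal_def Var_def monom_mem_mon_ideal vdeg_ge_1_iff mem_Collect_eq
  by (auto simp: lookup_single when_def)

lemma ideal_var_ideal:
  "ideal (var_ideal C :: ('n::finite, 'k::field) mpoly set) cring_class_ops"
  by (simp add: var_ideal_def ideal_mon_ideal upclosed_vdeg)

lemma not_mem_var_ideal:
  "f \<notin> var_ideal C \<longleftrightarrow> (\<exists>a\<in>Poly_Mapping.keys f. vdeg C a = 0)"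
  by (simp add: var_ideal_def mon_ideal_def subset_iff Bex_def not_le)

lemma edge_ideal_eq:
  "edge_ideal \<E> = (mon_ideal {e. \<exists>S\<in>\<E>. \<forall>k\<in>S. Poly_Mapping.lookup e k \<ge> 1} ::
    ('n::finite, 'k::field) mpoly set)"
proof -
  have *: "(\<forall>k. Poly_Mapping.lookup (indic S) k \<le> Poly_Mapping.lookup e k) \<longleftrightarrow>
      (\<forall>k\<in>S. Poly_Mapping.lookup e k \<ge> 1)" for S :: "'n set" and e
    by (auto simp: of_bool_def)
  have "{c + g | c g. g \<in> indic ` \<E>} = {e. \<exists>S\<in>\<E>. \<exists>c. e = c + indic S}" by blast
  also have "\<dots> = {e. \<exists>S\<in>\<E>. \<forall>k\<in>S. Poly_Mapping.lookup e k \<ge> 1}"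
    by (simp only: exp_le_iff *)
  finally show ?thesis
    using ideal_gen_monom[of "indic ` \<E>", where ?'k = 'k]
    by (simp add: edge_ideal_def image_image)
qed

lemma ideal_edge_ideal: "ideal (edge_ideal \<E> :: ('n::finite, 'k::field) mpoly set) cring_class_ops"
  unfolding edge_ideal_def by (rule ideal_gen_ideal)

lemma edge_ideal_subset_iff:
  assumes "ideal J cring_class_ops"
  shows "edge_ideal \<E> \<subseteq> J \<longleftrightarrow> (\<forall>S\<in>\<E>. monomial (indic S) \<in> (J :: ('n::finite, 'k::field) mpoly set))"
proof
  assume "edge_ideal \<E> \<subseteq> J"
  then show "\<forall>S\<in>\<E>. monomial (indic S) \<in> J"
    unfolding edge_ideal_def by (auto intro: ideal_genI)
next
  assume "\<forall>S\<in>\<E>. monomial (indic S) \<in> J"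
  then show "edge_ideal \<E> \<subseteq> J"
    unfolding edge_ideal_def
    by (intro ring.genideal_minimal[OF ring_class assms]) (simp add: image_subset_iff)
qed

lemma edge_ideal_subset_var_ideal:
  "edge_ideal \<E> \<subseteq> (var_ideal C :: ('n::finite, 'k::field) mpoly set) \<longleftrightarrow> cover \<E> C"
proof -
  have "monomial (indic S) \<in> (var_ideal C :: ('n, 'k) mpoly set) \<longleftrightarrow> C \<inter> S \<noteq> {}" for S
    unfolding var_ideal_def monom_mem_mon_ideal vdeg_ge_1_iff mem_Collect_eq lookup_exp_of
    by (auto simp: of_bool_def)
  then show ?thesis
    by (simp only: edge_ideal_subset_iff[OF ideal_var_ideal] cover_def)
qed

text \<open>An element outside this ideal has a term that involves no variable of \<open>C\<close>. The product of two such
  elements again has such a term, because the weight \<open>vdeg C\<close> is additive.\<close>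

lemma prime_var_ideal:
  "primeideal (var_ideal C :: ('n::{finite,linorder}, 'k::field) mpoly set) cring_class_ops"
  unfolding primeideal_class_iff
proof (intro conjI allI impI)
  show "ideal (var_ideal C :: ('n, 'k) mpoly set) cring_class_ops"
    by (rule ideal_var_ideal)
  show "1 \<notin> (var_ideal C :: ('n, 'k) mpoly set)"
    by (simp add: var_ideal_def mon_ideal_def vdeg_def)
  fix s f :: "('n, 'k) mpoly" assume sf: "s * f \<in> var_ideal C"
  show "s \<in> var_ideal C \<or> f \<in> var_ideal C"
  proof (rule ccontr)
    assume "\<not> (s \<in> var_ideal C \<or> f \<in> var_ideal C)"
    then obtain a b where ab: "a \<in> Poly_Mapping.keys s" "vdeg C a = 0"
      "b \<in> Poly_Mapping.keys f" "vdeg C b = 0"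
      by (simp add: not_mem_var_ideal) blast
    obtain c where "c \<in> Poly_Mapping.keys (s * f)" "vdeg C c \<le> vdeg C a + vdeg C b"
      using key_of_mult[of "vdeg C", OF vdeg_add ab(1,3)] .
    then have "s * f \<notin> var_ideal C" using ab by (auto simp: not_mem_var_ideal)
    then show False using sf by simp
  qed
qed

lemma var_ideal_subset:
  assumes P: "ideal P cring_class_ops" and C: "\<And>k. k \<in> C \<Longrightarrow> Var k \<in> P"
  shows "var_ideal C \<subseteq> (P :: ('n::finite, 'k::field) mpoly set)"
  unfolding var_ideal_def
proof (rule mon_ideal_subset[OF P])
  fix e assume "e \<in> {e. vdeg C e \<ge> 1}"
  then obtain k where k: "k \<in> C" "Poly_Mapping.lookup e k \<noteq> 0"
    unfolding mem_Collect_eq vdeg_ge_1_iff by blast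
  then have "\<exists>c. e = c + Poly_Mapping.single k 1"
    unfolding exp_le_iff by (simp add: lookup_single when_def)
  then obtain c where c: "e = c + Poly_Mapping.single k 1" by blast
  show "monomial e \<in> P" using C[OF k(1)] P unfolding c monom_add
    by (simp add: ideal_class_iff Var_def)
qed

lemma indic_eq_sum: "indic S = (\<Sum>k\<in>S. Poly_Mapping.single k 1)"
  by (rule poly_mapping_eqI) (simp add: lookup_sum lookup_single when_def)

text \<open>A prime ideal that contains a product of variables contains one of the variables.\<close>

lemma prime_cover_of_vars:
  fixes P :: "('n::finite, 'k::field) mpoly set"
  assumes P: "primeideal P cring_class_ops" and I: "edge_ideal \<E> \<subseteq> P"
  shows "cover \<E> {k. Var k \<in> P}"
proof -
  have "\<exists>k\<in>S. Var k \<in> P" if "(\<Prod>k\<in>S. Var k) \<in> P" for S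
    using finite[of S] that P
    by (induction S rule: finite_induct) (auto simp: primeideal_class_iff)
  moreover have "monomial (indic S) = (\<Prod>k\<in>S. Var k :: ('n, 'k) mpoly)" for S
    by (simp only: indic_eq_sum monom_sum Var_def)
  ultimately show ?thesis
    using I P by (fastforce simp: edge_ideal_subset_iff primeideal_class_iff cover_def)
qed

definition minimal_cover :: "'n set set \<Rightarrow> 'n set \<Rightarrow> bool"
  where "minimal_cover \<E> C \<longleftrightarrow> cover \<E> C \<and> (\<forall>D. cover \<E> D \<and> D \<subseteq> C \<longrightarrow> D = C)"

text \<open>For a prime \<open>P\<close> over the edge ideal, the variables in \<open>P\<close> form a cover \<open>C\<close>, and \<open>var_ideal C\<close> is a
  prime between the edge ideal and \<open>P\<close>. So the minimal primes are the minimal ones among the ideals of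
  covers, and these ideals are ordered like the covers.\<close>

lemma minimal_primes_edge_ideal:
  "minimal_primes (edge_ideal \<E> :: ('n::{finite,linorder}, 'k::field) mpoly set) =
    var_ideal ` {C. minimal_cover \<E> C}"
proof (intro equalityI subsetI)
  fix P :: "('n, 'k) mpoly set" assume "P \<in> minimal_primes (edge_ideal \<E>)"
  then have P: "primeideal P cring_class_ops" "edge_ideal \<E> \<subseteq> P"
    and Q: "\<forall>Q. primeideal Q cring_class_ops \<and> edge_ideal \<E> \<subseteq> Q \<and> Q \<subseteq> P \<longrightarrow> Q = P"
    by (simp_all add: minimal_primes_def)
  have min: "var_ideal D = P" if "cover \<E> D" "var_ideal D \<subseteq> P" for D
    using Q[rule_format, of "var_ideal D"] that prime_var_ideal[of D]
    by (simp add: edge_ideal_subset_var_ideal)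
  define C where "C = {k. Var k \<in> P}"
  have C: "cover \<E> C" using prime_cover_of_vars[OF P] by (simp add: C_def)
  have CP: "var_ideal C \<subseteq> P"
    using P by (intro var_ideal_subset) (auto simp: C_def primeideal_class_iff)
  have "D = C" if D: "cover \<E> D" "D \<subseteq> C" for D
  proof -
    have "var_ideal D \<subseteq> P"
      using P D by (intro var_ideal_subset) (auto simp: C_def primeideal_class_iff)
    then have "var_ideal D = P" by (rule min[OF D(1)])
    then have "Var k \<in> P \<longleftrightarrow> k \<in> D" for k using Var_mem_var_ideal[of k D] by blast
    then show "D = C" by (simp add: C_def)
  qed
  then show "P \<in> var_ideal ` {C. minimal_cover \<E> C}"
    using C min[OF C CP] by (auto simp: minimal_cover_def)
next
  fix P :: "('n, 'k) mpoly set" assume "P \<in> var_ideal ` {C. minimal_cover \<E> C}"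
  then obtain C where C: "P = var_ideal C" "minimal_cover \<E> C" by auto
  have "Q = P" if Q: "primeideal Q cring_class_ops" "edge_ideal \<E> \<subseteq> Q" "Q \<subseteq> P" for Q
  proof -
    have "{k. Var k \<in> Q} \<subseteq> C" using Q(3) C Var_mem_var_ideal by blast
    then have "{k. Var k \<in> Q} = C"
      using C(2) prime_cover_of_vars[OF Q(1,2)] by (simp add: minimal_cover_def)
    then have "P \<subseteq> Q"
      unfolding C using Q(1) by (intro var_ideal_subset) (auto simp: primeideal_class_iff)
    then show "Q = P" using Q(3) by simp
  qed
  then show "P \<in> minimal_primes (edge_ideal \<E>)"
    using C prime_var_ideal[of C] by (simp add: minimal_primes_def minimal_cover_def
      edge_ideal_subset_var_ideal)
qed

lemma ideal_power_edge_subset: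
  assumes "cover \<E> C"
  shows "ideal_power (edge_ideal \<E>) r \<subseteq>
    (mon_ideal {e. r \<le> vdeg C e} :: ('n::finite, 'k::field) mpoly set)"
proof (induction r)
  case 0
  then show ?case by (simp add: mon_ideal_def)
next
  case (Suc r)
  show ?case
  proof
    fix x :: "('n, 'k) mpoly" assume "x \<in> ideal_power (edge_ideal \<E>) (Suc r)"
    then show "x \<in> mon_ideal {e. Suc r \<le> vdeg C e}"
      unfolding ideal_power_Suc
    proof (induction rule: ideal_prod.induct)
      case (prod i j)
      have "i \<in> mon_ideal {e. r \<le> vdeg C e}" using Suc prod by auto
      moreover have "j \<in> mon_ideal {e. 1 \<le> vdeg C e}"
        using prod assms edge_ideal_subset_var_ideal[of \<E> C, where ?'k = 'k]
        by (auto simp: var_ideal_def)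
      ultimately show ?case
        using keys_mult[of i j] by (fastforce simp: mon_ideal_def class_simps vdeg_add)
    next
      case (sum s1 s2)
      then show ?case
        using ideal_mon_ideal[OF upclosed_vdeg, where ?'k = 'k]
        unfolding ideal_class_iff plus_class by blast
    qed
  qed
qed

text \<open>A variable that belongs to no such edge could be dropped from the cover.\<close>

lemma minimal_cover_edge:
  assumes "minimal_cover \<E> C" and "k \<in> C"
  obtains S where "S \<in> \<E>" and "S \<inter> C = {k}"
proof -
  have "\<not> cover \<E> (C - {k})" using assms by (auto simp: minimal_cover_def)
  then obtain S where S: "S \<in> \<E>" "(C - {k}) \<inter> S = {}" unfolding cover_def by blast
  moreover have "C \<inter> S \<noteq> {}" using assms(1) S(1) by (simp add: minimal_cover_def cover_def)
  ultimately have "S \<inter> C = {k}" by blast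
  with S(1) show thesis by (rule that)
qed

text \<open>If \<open>S\<close> is an edge that meets \<open>C\<close> only in \<open>k\<close>, then \<open>x\<^sub>k\<close> times the product of all variables outside
  \<open>C\<close> is divisible by the monomial of \<open>S\<close>. Each of the \<open>r\<close> variables of \<open>C\<close> in \<open>x\<^sup>e\<close> uses up one
  factor \<open>monomial (indic (- C))\<close>.\<close>

lemma monom_mem_power_localized:
  assumes C: "minimal_cover \<E> C" and "r \<le> vdeg C e"
  shows "monomial (indic (- C)) ^ r * monomial e \<in>
    (ideal_power (edge_ideal \<E>) r :: ('n::finite, 'k::field) mpoly set)"
  using assms(2)
proof (induction r arbitrary: e)
  case 0
  then show ?case unfolding ideal_power_0 by simp
next
  case (Suc r)
  then have "vdeg C e \<ge> 1" by simp
  then obtain k where k: "k \<in> C" "Poly_Mapping.lookup e k \<noteq> 0"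
    unfolding mem_Collect_eq vdeg_ge_1_iff by blast
  then have "\<exists>c. e = c + Poly_Mapping.single k 1"
    unfolding exp_le_iff by (simp add: lookup_single when_def)
  then obtain c where c: "e = c + Poly_Mapping.single k 1" by blast
  have "vdeg C (Poly_Mapping.single k 1) = 1"
    using k by (simp add: vdeg_def lookup_single when_def)
  then have "r \<le> vdeg C c" using Suc.prems by (simp add: c vdeg_add)
  note IH = Suc.IH[OF this]
  obtain S where S: "S \<in> \<E>" "S \<inter> C = {k}" using minimal_cover_edge[OF C k(1)] .
  then have "\<forall>l\<in>S. Poly_Mapping.lookup (indic (- C) + Poly_Mapping.single k 1) l \<ge> 1"
    by (auto simp: lookup_add lookup_single when_def)
  then have "monomial (indic (- C) + Poly_Mapping.single k 1) \<in>
    (edge_ideal \<E> :: ('n, 'k) mpoly set)"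
    unfolding edge_ideal_eq monom_mem_mon_ideal using S(1) by blast
  from mult_mem_ideal_power_Suc[OF IH this]
  show ?case by (simp add: c monom_add mult_ac)
qed

text \<open>Membership in the symbolic power is tested at the primes of the minimal covers only. The condition
  for all covers follows, since each cover contains a minimal one and has at least its degree.\<close>

theorem symbolic_power_edge_ideal:
  "symbolic_power (edge_ideal \<E>) r =
    (mon_ideal {e. \<forall>C. cover \<E> C \<longrightarrow> r \<le> vdeg C e} :: ('n::{finite,linorder}, 'k::field) mpoly set)"
    (is "_ = ?M")
proof -
  let ?I = "edge_ideal \<E> :: ('n, 'k) mpoly set"
  have min: "\<exists>D\<subseteq>C. minimal_cover \<E> D" if "cover \<E> C" for C
    using finite[of C] that
  proof (induction C rule: finite_psubset_induct)
    case (psubset C)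
    then show ?case unfolding minimal_cover_def by (metis order_refl psubsetI subset_trans)
  qed
  have sym: "symbolic_power ?I r =
      {f. \<forall>C. minimal_cover \<E> C \<longrightarrow> (\<exists>s. s \<notin> var_ideal C \<and> s * f \<in> ideal_power ?I r)}"
    by (auto simp: symbolic_power_eq[OF ideal_edge_ideal] minimal_primes_edge_ideal)
  show ?thesis
  proof (intro equalityI subsetI)
    fix f assume f: "f \<in> symbolic_power ?I r"
    have "r \<le> vdeg C b" if b: "b \<in> Poly_Mapping.keys f" and C: "cover \<E> C" for b C
    proof -
      \<comment> \<open>A factor from outside the prime of \<open>D\<close> has a term of degree \<open>0\<close>, so it cannot raise the degree.\<close>
      obtain D where D: "D \<subseteq> C" "minimal_cover \<E> D" using min[OF C] by auto
      then obtain s where s: "s \<notin> var_ideal D" "s * f \<in> ideal_power ?I r" using f sym by auto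
      then obtain a where a: "a \<in> Poly_Mapping.keys s" "vdeg D a = 0"
        by (auto simp: not_mem_var_ideal)
      obtain c where c: "c \<in> Poly_Mapping.keys (s * f)" "vdeg D c \<le> vdeg D a + vdeg D b"
        using key_of_mult[of "vdeg D", OF vdeg_add a(1) b] .
      have "s * f \<in> mon_ideal {e. r \<le> vdeg D e}"
        using s(2) D ideal_power_edge_subset[of \<E> D r, where ?'k = 'k]
        by (auto simp: minimal_cover_def)
      then have "r \<le> vdeg D c" using c(1) by (auto simp: mon_ideal_def)
      also have "\<dots> \<le> vdeg C b" using c(2) a(2) vdeg_mono[OF D(1), of b] by simp
      finally show ?thesis .
    qed
    then show "f \<in> ?M" by (auto simp: mon_ideal_def)
  next
    fix f assume f: "f \<in> ?M"
    have "\<exists>s. s \<notin> var_ideal C \<and> s * f \<in> ideal_power ?I r" if C: "minimal_cover \<E> C" for C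
    proof (intro exI conjI)
      \<comment> \<open>One denominator serves for all terms of \<open>f\<close>.\<close>
      let ?s = "monomial (indic (- C)) ^ r :: ('n, 'k) mpoly"
      have "monomial (indic (- C)) \<notin> (var_ideal C :: ('n, 'k) mpoly set)"
        by (simp add: var_ideal_def monom_mem_mon_ideal vdeg_def)
      then show "?s \<notin> var_ideal C"
        using prime_var_ideal[of C, where ?'k = 'k]
        by (induction r) (auto simp: primeideal_class_iff)
      note I = ideal_ideal_power[OF ideal_edge_ideal]
      have *: "?s * monomial e \<in> ideal_power ?I r" if "e \<in> Poly_Mapping.keys f" for e
        using f that C
        by (intro monom_mem_power_localized) (auto simp: mon_ideal_def minimal_cover_def)
      have "(\<Sum>e\<in>Poly_Mapping.keys f. Const (Poly_Mapping.lookup f e) * (?s * monomial e))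
          \<in> ideal_power ?I r"
        by (rule ideal_sum_closed[OF I], rule ideal_mult_closed[OF I], rule *)
      also have "(\<Sum>e\<in>Poly_Mapping.keys f. Const (Poly_Mapping.lookup f e) * (?s * monomial e))
          = ?s * (\<Sum>e\<in>Poly_Mapping.keys f. Const (Poly_Mapping.lookup f e) * monomial e)"
        by (simp add: sum_distrib_left mult.left_commute)
      also have "\<dots> = ?s * f" by (simp only: mpoly_eq_sum_terms[of f, symmetric])
      finally show "?s * f \<in> ideal_power ?I r" .
    qed
    then show "f \<in> symbolic_power ?I r" using sym by blast
  qed
qed

section \<open>Square-free monomials and the map psi\<close>

lemma monom_power:
  fixes e :: "'n::finite \<Rightarrow>\<^sub>0 nat"
  shows "monomial e ^ n = (monomial (exp_of (\<lambda>k. n * Poly_Mapping.lookup e k)) :: ('n, 'k::field) mpoly)"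
proof -
  have "exp_of (\<lambda>k. n * Poly_Mapping.lookup e k) = (\<Sum>i<n. e)"
    by (rule poly_mapping_eqI) (simp add: lookup_sum)
  then show ?thesis by (simp only: monom_sum prod_constant card_lessThan)
qed

lemma Var_dvd_monomial_iff:
  "Var k dvd (monomial e :: ('n::finite, 'k::field) mpoly) \<longleftrightarrow> Poly_Mapping.lookup e k \<noteq> 0"
proof
  assume "Var k dvd (monomial e :: ('n, 'k) mpoly)"
  then obtain p :: "('n, 'k) mpoly" where "monomial e = Var k * p" by (auto simp: dvd_def)
  then have "e \<in> Poly_Mapping.keys (Var k * p)" by (metis insertI1 keys_single one_neq_zero)
  then obtain b where "e = Poly_Mapping.single k 1 + b"
    using keys_mult[of "Var k" p] by (auto simp: Var_def)
  then show "Poly_Mapping.lookup e k \<noteq> 0" by (simp add: lookup_add)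
next
  assume "Poly_Mapping.lookup e k \<noteq> 0"
  then have "\<exists>c. e = c + Poly_Mapping.single k 1"
    unfolding exp_le_iff by (simp add: lookup_single when_def)
  then obtain c where "e = c + Poly_Mapping.single k 1" by blast
  then show "Var k dvd (monomial e :: ('n, 'k) mpoly)" by (simp only: monom_add Var_def dvd_triv_right)
qed

lemma Var_square: "Var k ^ 2 = (monomial (Poly_Mapping.single k 2) :: ('v, 'k::field) mpoly)"
  by (simp add: Var_def power2_eq_square mult_single flip: single_add) (simp add: numeral_2_eq_2)

text \<open>If some exponent is at least \<open>2\<close>, then the square of that variable divides the monomial, and a
  variable is not a unit.\<close>

lemma squarefree_monomial_exponent:
  fixes e :: "'n::finite \<Rightarrow>\<^sub>0 nat"
  assumes sf: "squarefree (monomial e :: ('n, 'k::field) mpoly)"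
  shows "e = indic {k. Poly_Mapping.lookup e k \<noteq> 0}"
proof (rule exp_eqI)
  fix k
  have "\<not> Poly_Mapping.lookup e k \<ge> 2"
  proof
    assume "Poly_Mapping.lookup e k \<ge> 2"
    then have "\<exists>c. e = c + Poly_Mapping.single k 2"
      unfolding exp_le_iff by (simp add: lookup_single when_def)
    then obtain c where "e = c + Poly_Mapping.single k 2" by blast
    then have "Var k ^ 2 dvd (monomial e :: ('n, 'k) mpoly)"
      by (simp only: monom_add Var_square dvd_triv_right)
    then have "Var k dvd (monomial 0 :: ('n, 'k) mpoly)"
      using sf by (simp add: squarefree_def)
    then show False by (simp only: Var_dvd_monomial_iff lookup_zero)
  qed
  then show "Poly_Mapping.lookup e k = of_bool (k \<in> {k. Poly_Mapping.lookup e k \<noteq> 0})"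
    by (auto simp: of_bool_def)
qed

lemma minimal_squarefree_generators_edges:
  fixes m :: "nat \<Rightarrow> ('n::finite, 'k::field) mpoly"
  assumes "minimal_squarefree_generators I q m"
  obtains S where "\<And>j. j \<in> {1..q} \<Longrightarrow> m j = monomial (indic (S j))"
    and "I = edge_ideal (S ` {1..q})"
proof -
  have "\<exists>T. m j = monomial (indic T)" if "j \<in> {1..q}" for j
  proof -
    have "is_monomial (m j)" and sf: "squarefree (m j)"
      using assms that by (simp_all add: minimal_squarefree_generators_def)
    then obtain e where e: "m j = monomial e" unfolding is_monomial_def by blast
    have "m j = monomial (indic {k. Poly_Mapping.lookup e k \<noteq> 0})"
      unfolding e
      using squarefree_monomial_exponent[OF sf[unfolded e]] by (rule arg_cong[where f = monomial])
    then show ?thesis by blast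
  qed
  then have "\<forall>j\<in>{1..q}. \<exists>T. m j = monomial (indic T)" by blast
  from bchoice[OF this] obtain S where "\<forall>j\<in>{1..q}. m j = monomial (indic (S j))" ..
  then have S: "\<And>j. j \<in> {1..q} \<Longrightarrow> m j = monomial (indic (S j))" by blast
  have "I = ideal_gen (m ` {1..q})"
    using assms by (simp add: minimal_squarefree_generators_def)
  also have "m ` {1..q} = (\<lambda>T. monomial (indic T)) ` (S ` {1..q})"
    using S by (simp add: image_image)
  finally show thesis using S that by (simp add: edge_ideal_def)
qed

definition incidence :: "nat \<Rightarrow> (nat \<Rightarrow> 'n set) \<Rightarrow> 'n \<Rightarrow> nat set"
  where "incidence q S k = {j \<in> {1..q}. k \<in> S j}"

text \<open>The variable \<open>x\<^sub>k\<close> occurs in the image of \<open>y\<^sub>A\<close> for exactly one \<open>A \<subseteq> {1..q}\<close>, its incidence set.\<close>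

lemma psi_monomial:
  fixes m :: "nat \<Rightarrow> ('n::finite, 'k::field) mpoly"
  assumes m: "\<And>j. j \<in> {1..q} \<Longrightarrow> m j = monomial (indic (S j))"
    and c: "Poly_Mapping.keys c \<subseteq> Pow {1..q}"
  shows "psi q m (monomial c) = monomial (exp_of (\<lambda>k. Poly_Mapping.lookup c (incidence q S k)))"
proof -
  let ?K = "\<lambda>A. {k. \<forall>j\<in>{1..q}. Var k dvd m j \<longleftrightarrow> j \<in> A}"
  have K: "(\<Prod>k\<in>?K A. Var k) = (monomial (indic {k. incidence q S k = A}) :: ('n, 'k) mpoly)"
    if "A \<in> Poly_Mapping.keys c" for A
  proof -
    have A: "A \<subseteq> {1..q}" using that c by blast
    have "Var k dvd m j \<longleftrightarrow> k \<in> S j" if "j \<in> {1..q}" for j k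
      by (simp add: m[OF that] Var_dvd_monomial_iff of_bool_def)
    then have "(\<forall>j\<in>{1..q}. Var k dvd m j \<longleftrightarrow> j \<in> A) \<longleftrightarrow> incidence q S k = A" for k
      unfolding incidence_def using A by blast
    then have "?K A = {k. incidence q S k = A}" by simp
    then show ?thesis by (simp only: indic_eq_sum monom_sum Var_def)
  qed
  have "psi q m (monomial c) = (\<Prod>A\<in>Poly_Mapping.keys c. (\<Prod>k\<in>?K A. Var k) ^ Poly_Mapping.lookup c A)"
    by (simp add: psi_def subst_hom_def Const_def)
  also have "\<dots> = (\<Prod>A\<in>Poly_Mapping.keys c. monomial (exp_of (\<lambda>k. Poly_Mapping.lookup c A *
      of_bool (incidence q S k = A))))"
    by (rule prod.cong[OF refl]) (simp only: K monom_power lookup_exp_of mem_Collect_eq)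
  also have "\<dots> = monomial (\<Sum>A\<in>Poly_Mapping.keys c. exp_of (\<lambda>k. Poly_Mapping.lookup c A *
      of_bool (incidence q S k = A)))"
    by (simp only: monom_sum)
  also have "(\<Sum>A\<in>Poly_Mapping.keys c. exp_of (\<lambda>k. Poly_Mapping.lookup c A *
      of_bool (incidence q S k = A))) = exp_of (\<lambda>k. Poly_Mapping.lookup c (incidence q S k))"
    by (rule exp_eqI) (simp add: lookup_sum of_bool_def if_distrib in_keys_iff cong: if_cong)
  finally show ?thesis .
qed

lemma lookup_sum_single:
  "finite F \<Longrightarrow> Poly_Mapping.lookup (\<Sum>A\<in>F. Poly_Mapping.single A n) B = (if B \<in> F then n else 0)"
  by (simp add: lookup_sum lookup_single when_def)

lemma finite_nonempty_subsets: "finite (nonempty_subsets q)"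
  by (rule finite_subset[of _ "Pow {1..q}"]) (auto simp: nonempty_subsets_def)

definition f_exp :: "nat \<Rightarrow> (nat \<Rightarrow> 'n::finite set) \<Rightarrow> nat set \<Rightarrow> 'n \<Rightarrow>\<^sub>0 nat"
  where "f_exp q S X = exp_of (\<lambda>k. if X \<subseteq> incidence q S k then 2
    else if X \<inter> incidence q S k \<noteq> {} then 1 else 0)"

lemma psi_f_elem:
  fixes m :: "nat \<Rightarrow> ('n::finite, 'k::field) mpoly"
  assumes m: "\<And>j. j \<in> {1..q} \<Longrightarrow> m j = monomial (indic (S j))"
    and X: "X \<noteq> {}" "X \<subseteq> {1..q}"
  shows "psi q m (f_elem q X) = monomial (f_exp q S X)"
proof -
  let ?F = "{A \<in> nonempty_subsets q. X \<subseteq> A}"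
  let ?G = "{A \<in> nonempty_subsets q. X \<inter> A \<noteq> {} \<and> X \<inter> ({1..q} - A) \<noteq> {}}"
  define c where "c = (\<Sum>A\<in>?F. Poly_Mapping.single A 2) + (\<Sum>A\<in>?G. Poly_Mapping.single A (1::nat))"
  have fin: "finite ?F" "finite ?G" using finite_nonempty_subsets[of q] by simp_all
  have lc: "Poly_Mapping.lookup c A = (if A \<in> ?F then 2 else 0) + (if A \<in> ?G then 1 else 0)" for A
    by (simp only: c_def lookup_add lookup_sum_single[OF fin(1)] lookup_sum_single[OF fin(2)])
  have f: "f_elem q X = (monomial c :: (nat set, 'k) mpoly)"
    by (simp only: f_elem_def c_def monom_add monom_sum Var_square) (simp only: Var_def)
  have "A \<in> Pow {1..q}" if "A \<in> Poly_Mapping.keys c" for A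
  proof -
    have "Poly_Mapping.lookup c A \<noteq> 0" using that by (simp add: in_keys_iff)
    then have "A \<in> nonempty_subsets q" unfolding lc by (auto split: if_splits)
    then show ?thesis by (auto simp only: nonempty_subsets_def)
  qed
  then have keys: "Poly_Mapping.keys c \<subseteq> Pow {1..q}" by blast
  have "Poly_Mapping.lookup c (incidence q S k) = Poly_Mapping.lookup (f_exp q S X) k" for k
    using X unfolding lc by (auto simp: f_exp_def nonempty_subsets_def incidence_def)
  then have "exp_of (\<lambda>k. Poly_Mapping.lookup c (incidence q S k)) = f_exp q S X"
    by (intro poly_mapping_eqI) simp
  then show ?thesis unfolding f by (simp only: psi_monomial[OF m keys])
qed

text \<open>Apart from the factor \<open>eps q 1 ^ (r - 2)\<close>, whose image is a power of \<open>m 1\<close>, the element \<open>h_elem r q\<close>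
  is \<open>f_elem q {1..q}\<close>: the variable of the full set occurs twice and every other one once.\<close>

lemma psi_h_elem:
  fixes m :: "nat \<Rightarrow> ('n::finite, 'k::field) mpoly"
  assumes m: "\<And>j. j \<in> {1..q} \<Longrightarrow> m j = monomial (indic (S j))" and q: "q \<ge> 1"
  shows "psi q m (h_elem r q) = monomial (f_exp q S {1..q}) * m 1 ^ (r - 2)"
proof -
  let ?F = "nonempty_subsets q" and ?G = "{A \<in> nonempty_subsets q. 1 \<in> A}"
  define c where "c = Poly_Mapping.single {1..q} 1 + (\<Sum>A\<in>?F. Poly_Mapping.single A 1)
    + (\<Sum>i<r - 2. \<Sum>A\<in>?G. Poly_Mapping.single A (1::nat))"
  have lc: "Poly_Mapping.lookup c A = (if A = {1..q} then 1 else 0) + (if A \<in> ?F then 1 else 0)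
      + (r - 2) * (if A \<in> ?G then 1 else 0)" for A
  proof -
    have fin: "finite ?F" "finite ?G" using finite_nonempty_subsets[of q] by simp_all
    have "Poly_Mapping.lookup (Poly_Mapping.single {1..q} (1::nat)) A = (if A = {1..q} then 1 else 0)"
      by (auto simp: lookup_single when_def)
    moreover have "Poly_Mapping.lookup (\<Sum>i<r - 2. \<Sum>A\<in>?G. Poly_Mapping.single A (1::nat)) A =
        (r - 2) * (if A \<in> ?G then 1 else 0)"
      by (simp only: lookup_sum[of _ "{..<r - 2}"] lookup_sum_single[OF fin(2)] sum_constant
          card_lessThan of_nat_id)
    ultimately show ?thesis
      by (simp only: c_def lookup_add lookup_sum_single[OF fin(1)])
  qed
  have h: "h_elem r q = (monomial c :: (nat set, 'k) mpoly)"
    by (simp only: h_elem_def eps_def c_def monom_add monom_sum Var_def prod_constant card_lessThan)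
  have "A \<in> Pow {1..q}" if "A \<in> Poly_Mapping.keys c" for A
  proof -
    have "Poly_Mapping.lookup c A \<noteq> 0" using that by (simp add: in_keys_iff)
    then have "A \<in> nonempty_subsets q \<or> A = {1..q}" unfolding lc by (auto split: if_splits)
    then show ?thesis by (auto simp only: nonempty_subsets_def)
  qed
  then have keys: "Poly_Mapping.keys c \<subseteq> Pow {1..q}" by blast
  have "psi q m (h_elem r q) =
      monomial (exp_of (\<lambda>k. Poly_Mapping.lookup c (incidence q S k)))"
    unfolding h by (rule psi_monomial[OF m keys])
  also have "exp_of (\<lambda>k. Poly_Mapping.lookup c (incidence q S k)) =
      f_exp q S {1..q} + exp_of (\<lambda>k. (r - 2) * Poly_Mapping.lookup (indic (S 1)) k)"
    by (rule poly_mapping_eqI)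
      (use q in \<open>auto simp: lookup_add lc f_exp_def nonempty_subsets_def incidence_def\<close>)
  also have "monomial \<dots> = monomial (f_exp q S {1..q}) * m 1 ^ (r - 2)"
    using m[of 1] q by (simp only: monom_add monom_power atLeastAtMost_iff order_refl simp_thms)
  finally show ?thesis .
qed

section \<open>The second symbolic power\<close>

lemma cover_image_iff: "cover (S ` {1..q}) C \<longleftrightarrow> (\<forall>j\<in>{1..q}. \<exists>k\<in>C. k \<in> S j)"
  by (auto simp: cover_def)

lemma sum_ge_2:
  fixes g :: "'b \<Rightarrow> nat"
  assumes "finite C" and "k \<in> C" and "l \<in> C" and "g k \<ge> 2 \<or> k \<noteq> l \<and> g k \<ge> 1 \<and> g l \<ge> 1"
  shows "2 \<le> sum g C"
proof -
  have "sum g {k, l} \<le> sum g C" using assms by (intro sum_mono2) auto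
  then show ?thesis using assms(4) by (cases "k = l") auto
qed

text \<open>Some \<open>k\<close> in the cover lies in an edge \<open>S j\<close> with \<open>j \<in> X\<close>. If \<open>k\<close> does not lie in all edges indexed by
  \<open>X\<close>, then an edge that it misses is met by the cover in a second vertex.\<close>

lemma vdeg_f_exp:
  assumes C: "cover (S ` {1..q}) C" and X: "X \<noteq> {}" "X \<subseteq> {1..q}"
  shows "2 \<le> vdeg C (f_exp q S X)"
proof -
  obtain j k where jk: "j \<in> X" "k \<in> C" "k \<in> S j" using C X unfolding cover_image_iff by blast
  show ?thesis
  proof (cases "X \<subseteq> incidence q S k")
    case True
    then show ?thesis
      unfolding vdeg_def using jk by (intro sum_ge_2[of C k k]) (auto simp: f_exp_def)
  next
    case False
    then obtain i where i: "i \<in> X" "k \<notin> S i" using X by (auto simp: incidence_def)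
    then obtain l where l: "l \<in> C" "l \<in> S i" using C X unfolding cover_image_iff by blast
    have "j \<in> X \<inter> incidence q S k" "i \<in> X \<inter> incidence q S l" "k \<noteq> l"
      using i l jk X by (auto simp: incidence_def)
    then show ?thesis
      unfolding vdeg_def using jk l by (intro sum_ge_2[of C k l]) (auto simp: f_exp_def)
  qed
qed

text \<open>Let \<open>X\<close> index the edges inside the support \<open>Z\<close> of \<open>e\<close>. If \<open>X\<close> were empty, then the complement of \<open>Z\<close>
  would be a cover of degree \<open>0\<close>. If \<open>k\<close> lies in all edges indexed by \<open>X\<close>, then the complement of \<open>Z\<close>
  together with \<open>k\<close> is a cover, whose degree is the exponent of \<open>x\<^sub>k\<close>.\<close>

lemma f_exp_le_of_vdeg_ge_2:
  fixes S :: "nat \<Rightarrow> 'n::finite set"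
  assumes e: "\<And>C. cover (S ` {1..q}) C \<Longrightarrow> 2 \<le> vdeg C e"
  obtains X where "X \<noteq> {}" and "X \<subseteq> {1..q}"
    and "\<And>k. Poly_Mapping.lookup (f_exp q S X) k \<le> Poly_Mapping.lookup e k"
proof -
  define Z where "Z = {k. Poly_Mapping.lookup e k \<noteq> 0}"
  define X where "X = {j \<in> {1..q}. S j \<subseteq> Z}"
  have "X \<noteq> {}"
  proof
    assume "X = {}"
    then have "cover (S ` {1..q}) (- Z)" unfolding cover_image_iff X_def by blast
    then show False using e[of "- Z"] by (simp add: vdeg_def Z_def)
  qed
  moreover have "X \<subseteq> {1..q}" by (auto simp: X_def)
  moreover have "Poly_Mapping.lookup (f_exp q S X) k \<le> Poly_Mapping.lookup e k" for k
  proof (cases "X \<subseteq> incidence q S k")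
    case True
    then have "cover (S ` {1..q}) (insert k (- Z))"
      unfolding cover_image_iff X_def incidence_def by blast
    then have "2 \<le> vdeg (insert k (- Z)) e" by (rule e)
    also have "vdeg (insert k (- Z)) e = vdeg {k} e"
      unfolding vdeg_def by (rule sum.mono_neutral_right) (auto simp: Z_def)
    finally show ?thesis using True by (simp add: vdeg_def f_exp_def)
  next
    case False
    have "Poly_Mapping.lookup e k \<ge> 1" if "X \<inter> incidence q S k \<noteq> {}"
      using that by (auto simp: X_def incidence_def Z_def Suc_le_eq)
    then show ?thesis using False by (simp add: f_exp_def)
  qed
  ultimately show thesis by (rule that)
qed

lemma symbolic_square_exponents:
  "symbolic_power (edge_ideal (S ` {1..q})) 2 =
    (ideal_gen {monomial (f_exp q S X) | X. X \<noteq> {} \<and> X \<subseteq> {1..q}}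
      :: ('n::{finite,linorder}, 'k::field) mpoly set)"
proof -
  have "(\<forall>C. cover (S ` {1..q}) C \<longrightarrow> 2 \<le> vdeg C e) \<longleftrightarrow>
      (\<exists>X c. e = c + f_exp q S X \<and> X \<noteq> {} \<and> X \<subseteq> {1..q})" (is "?l \<longleftrightarrow> ?r") for e
  proof
    assume ?l
    then obtain X where X: "X \<noteq> {}" "X \<subseteq> {1..q}"
      "\<forall>k. Poly_Mapping.lookup (f_exp q S X) k \<le> Poly_Mapping.lookup e k"
      using f_exp_le_of_vdeg_ge_2[of S q e] by metis
    then have "\<exists>c. e = c + f_exp q S X" by (simp only: exp_le_iff simp_thms)
    then show ?r using X by blast
  next
    assume ?r
    then obtain X c where X: "e = c + f_exp q S X" "X \<noteq> {}" "X \<subseteq> {1..q}" by blast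
    show ?l
    proof (intro allI impI)
      fix C assume "cover (S ` {1..q}) C"
      from vdeg_f_exp[OF this X(2,3)] show "2 \<le> vdeg C e" by (simp add: X(1) vdeg_add)
    qed
  qed
  then have "{e. \<forall>C. cover (S ` {1..q}) C \<longrightarrow> 2 \<le> vdeg C e} =
      {e. \<exists>X c. e = c + f_exp q S X \<and> X \<noteq> {} \<and> X \<subseteq> {1..q}}"
    by (simp only:)
  also have "\<dots> = {c + g | c g. g \<in> f_exp q S ` {X. X \<noteq> {} \<and> X \<subseteq> {1..q}}}"
    by blast
  finally have "symbolic_power (edge_ideal (S ` {1..q})) 2 =
    (mon_ideal {c + g | c g. g \<in> f_exp q S ` {X. X \<noteq> {} \<and> X \<subseteq> {1..q}}}
      :: ('n, 'k) mpoly set)"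
    unfolding symbolic_power_edge_ideal by (simp only:)
  also have "\<dots> = ideal_gen (monomial ` f_exp q S ` {X. X \<noteq> {} \<and> X \<subseteq> {1..q}})"
    by (rule ideal_gen_monom[symmetric])
  also have "(monomial ` f_exp q S ` {X. X \<noteq> {} \<and> X \<subseteq> {1..q}} :: ('n, 'k) mpoly set) =
      {monomial (f_exp q S X) | X. X \<noteq> {} \<and> X \<subseteq> {1..q}}"
    by blast
  finally show ?thesis .
qed

lemma ideal_power_subset_symbolic_power:
  "ideal_power (edge_ideal \<E>) r \<subseteq>
    (symbolic_power (edge_ideal \<E>) r :: ('n::{finite,linorder}, 'k::field) mpoly set)"
  unfolding symbolic_power_edge_ideal
  using ideal_power_edge_subset[of \<E> _ r, where ?'k = 'k] by (auto simp: mon_ideal_def)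

lemma edge_monomial_mem: "T \<in> \<E> \<Longrightarrow> monomial (indic T) \<in> (edge_ideal \<E> :: ('n::finite, 'k::field) mpoly set)"
  unfolding edge_ideal_def by (intro ideal_genI imageI)

text \<open>For \<open>i = j\<close> this is the exponent of the square of a generator, so the lemma covers all nonempty sets
  \<open>X\<close> with at most two elements.\<close>

lemma f_exp_pair:
  assumes "i \<in> {1..q}" and "j \<in> {1..q}"
  shows "f_exp q S {i, j} = indic (S i) + indic (S j)"
  by (rule poly_mapping_eqI) (use assms in \<open>auto simp: f_exp_def lookup_add incidence_def\<close>)

lemma symbolic_square_mod_square:
  "symbolic_power (edge_ideal (S ` {1..q})) 2 =
    (ideal_gen (ideal_power (edge_ideal (S ` {1..q})) 2 \<union>
      (\<lambda>X. monomial (f_exp q S X)) ` {X. X \<subseteq> {1..q} \<and> 3 \<le> card X})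
      :: ('n::{finite,linorder}, 'k::field) mpoly set)" (is "?M = ideal_gen (?N \<union> ?G)")
proof
  have M: "ideal ?M cring_class_ops"
    unfolding symbolic_square_exponents by (rule ideal_gen_ideal)
  have "?G \<subseteq> ?M"
    unfolding symbolic_square_exponents by (auto intro!: ideal_genI)
  then show "ideal_gen (?N \<union> ?G) \<subseteq> ?M"
    by (intro ring.genideal_minimal[OF ring_class M] Un_least ideal_power_subset_symbolic_power)
  have "monomial (f_exp q S X) \<in> ideal_gen (?N \<union> ?G)" if X: "X \<noteq> {}" "X \<subseteq> {1..q}" for X
  proof (cases "3 \<le> card X")
    case True
    then show ?thesis using X by (intro ideal_genI) auto
  next
    case False
    have "finite X" using X finite_subset by auto
    then have "card X = 1 \<or> card X = 2" using False X card_0_eq[of X] by linarith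
    then obtain i j where ij: "X = {i, j}"
      unfolding card_1_singleton_iff card_2_iff One_nat_def by blast
    then have "monomial (f_exp q S X) = (monomial (indic (S i)) * monomial (indic (S j)) :: ('n, 'k) mpoly)"
      using X by (simp add: f_exp_pair monom_add)
    also have "\<dots> \<in> ?N"
      using X ij by (intro mult_mem_ideal_power_2 edge_monomial_mem) auto
    finally show ?thesis by (intro ideal_genI) simp
  qed
  then show "?M \<subseteq> ideal_gen (?N \<union> ?G)"
    unfolding symbolic_square_exponents
    by (intro ring.genideal_minimal[OF ring_class ideal_gen_ideal]) auto
qed

lemma card_subsets_ge_3:
  "card {X. X \<subseteq> {1..q} \<and> 3 \<le> card X} = 2 ^ q - 1 - q - (q choose 2)"
proof -
  let ?P = "\<lambda>i. {X. X \<subseteq> {1..q} \<and> card X = i}"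
  let ?B = "{X. X \<subseteq> {1..q} \<and> 3 \<le> card X}"
  have fin: "finite (?P i)" "finite ?B" for i by (auto intro: finite_subset[of _ "Pow {1..q}"])
  have "Pow {1..q} = ?P 0 \<union> ?P 1 \<union> ?P 2 \<union> ?B" by auto
  moreover have "card (?P 0 \<union> ?P 1 \<union> ?P 2 \<union> ?B) = card (?P 0 \<union> ?P 1 \<union> ?P 2) + card ?B"
    using fin by (intro card_Un_disjoint) auto
  moreover have "card (?P 0 \<union> ?P 1 \<union> ?P 2) = card (?P 0 \<union> ?P 1) + card (?P 2)"
    using fin by (intro card_Un_disjoint) auto
  moreover have "card (?P 0 \<union> ?P 1) = card (?P 0) + card (?P 1)"
    using fin by (intro card_Un_disjoint) auto
  moreover have "card (?P i) = q choose i" for i using n_subsets[of "{1..q}" i] by simp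
  moreover have "card (Pow {1..q}) = 2 ^ q" by (simp add: card_Pow)
  ultimately have "2 ^ q = 1 + q + (q choose 2) + card ?B" by simp
  then show ?thesis by simp
qed

section \<open>Two generators\<close>

text \<open>The case of a single generator is the one with \<open>A = B\<close>. The covers with at most two
  elements force a product of \<open>r\<close> generators to divide \<open>x\<^sup>e\<close>.\<close>

lemma symbolic_power_two_edges:
  "symbolic_power (edge_ideal {A, B}) r =
    (ideal_power (edge_ideal {A, B}) r :: ('n::{finite,linorder}, 'k::field) mpoly set)"
proof
  let ?I = "edge_ideal {A, B} :: ('n, 'k) mpoly set"
  show "ideal_power ?I r \<subseteq> symbolic_power ?I r" by (rule ideal_power_subset_symbolic_power)
  show "symbolic_power ?I r \<subseteq> ideal_power ?I r"
    unfolding symbolic_power_edge_ideal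
  proof (rule mon_ideal_subset[OF ideal_ideal_power[OF ideal_edge_ideal]])
    fix e assume "e \<in> {e. \<forall>C. cover {A, B} C \<longrightarrow> r \<le> vdeg C e}"
    then have e: "r \<le> vdeg C e" if "cover {A, B} C" for C using that by blast
    \<comment> \<open>The factor \<open>x\<^bsup>A\<^esup>\<close> is used as often as the vertices of \<open>A - B\<close> allow; inserting \<open>r\<close> also covers
      \<open>A \<subseteq> B\<close>.\<close>
    define a where "a = Min (insert r (Poly_Mapping.lookup e ` (A - B)))"
    have aA: "a \<le> Poly_Mapping.lookup e k" if "k \<in> A - B" for k
      unfolding a_def using that by (intro Min_le) auto
    have ar: "a \<le> r" unfolding a_def by (intro Min_le) auto
    have AB: "r \<le> Poly_Mapping.lookup e k" if "k \<in> A \<inter> B" for k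
      using e[of "{k}"] that by (simp add: cover_def vdeg_def)
    have Bl: "r - a \<le> Poly_Mapping.lookup e l" if l: "l \<in> B - A" for l
    proof -
      have "a \<in> insert r (Poly_Mapping.lookup e ` (A - B))" unfolding a_def by (intro Min_in) auto
      then consider "a = r" | k where "k \<in> A - B" "a = Poly_Mapping.lookup e k" by auto
      then show ?thesis
      proof cases
        case 2
        \<comment> \<open>The vertex \<open>k\<close> attains the minimum, so the cover \<open>{k, l}\<close> gives the bound at \<open>l\<close>.\<close>
        then have "cover {A, B} {k, l}" "k \<noteq> l" using l by (auto simp: cover_def)
        then show ?thesis using e[of "{k, l}"] 2 by (simp add: vdeg_def)
      qed simp
    qed
    let ?g = "exp_of (\<lambda>k. a * Poly_Mapping.lookup (indic A) k) +
      exp_of (\<lambda>k. (r - a) * Poly_Mapping.lookup (indic B) k)"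
    have "\<forall>k. Poly_Mapping.lookup ?g k \<le> Poly_Mapping.lookup e k"
      using aA ar AB Bl by (auto simp: lookup_add of_bool_def)
    then have "\<exists>c. e = c + ?g" unfolding exp_le_iff .
    then obtain c where c: "e = c + ?g" by blast
    have "monomial (indic A) ^ a * monomial (indic B) ^ (r - a) \<in> ideal_power ?I (a + (r - a))"
      by (intro mult_power_mem_ideal_power power_mem_ideal_power edge_monomial_mem) auto
    then have "monomial ?g \<in> ideal_power ?I r"
      using ar by (simp only: monom_add monom_power le_add_diff_inverse)
    then show "monomial e \<in> ideal_power ?I r"
      unfolding c monom_add[of c] by (rule ideal_mult_closed[OF ideal_ideal_power[OF ideal_edge_ideal]])
  qed
qed

section \<open>Powers and symbolic powers of square-free monomial ideals\<close>

theorem theorem5p10: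
  fixes I :: "('n::{finite,linorder}, 'k::field) mpoly set"
    and q :: nat
    and m :: "nat \<Rightarrow> ('n, 'k) mpoly"
  assumes "q \<ge> 1"
    and "minimal_squarefree_generators I q m"
  shows
    "(\<forall>r. q \<ge> 3 \<and> r \<ge> 2 \<and> psi q m (h_elem r q) \<notin> ideal_power I r
        \<longrightarrow> symbolic_power I r \<noteq> ideal_power I r) \<and>
     (q \<le> 2 \<longrightarrow> (\<forall>r\<ge>1. symbolic_power I r = ideal_power I r)) \<and>
     (q = 3 \<longrightarrow> symbolic_power I 2
        = ideal_sum (ideal_power I 2) (ideal_gen {psi q m (h_elem 2 3)})) \<and>
     symbolic_power I 2 = ideal_gen {psi q m (f_elem q X) | X. X \<noteq> {} \<and> X \<subseteq> {1..q}} \<and>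
     sdefect 2 I \<le> enat (2 ^ q - 1 - q - (q choose 2))"
proof -
  obtain S where m: "\<And>j. j \<in> {1..q} \<Longrightarrow> m j = monomial (indic (S j))"
    and I: "I = edge_ideal (S ` {1..q})"
    by (rule minimal_squarefree_generators_edges[OF assms(2)], rule that)
  note idI = ideal_edge_ideal[of "S ` {1..q}", where ?'k = 'k, folded I]
  have sq: "symbolic_power I 2 = ideal_gen (ideal_power I 2 \<union>
      (\<lambda>X. monomial (f_exp q S X)) ` {X. X \<subseteq> {1..q} \<and> 3 \<le> card X})"
    unfolding I by (rule symbolic_square_mod_square)
  have psi_h: "psi q m (h_elem r q) = monomial (f_exp q S {1..q}) * m 1 ^ (r - 2)" for r
    by (rule psi_h_elem[OF _ assms(1)]) (rule m)
  have h: "psi q m (h_elem r q) \<in> symbolic_power I r" if "r \<ge> 2" for r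
  proof -
    have "r \<le> vdeg C (f_exp q S {1..q} + exp_of (\<lambda>k. (r - 2) * Poly_Mapping.lookup (indic (S 1)) k))"
      if C: "cover (S ` {1..q}) C" for C
    proof -
      have "2 \<le> vdeg C (f_exp q S {1..q})" using C assms(1) by (intro vdeg_f_exp) auto
      moreover obtain k where "k \<in> C" "k \<in> S 1"
        using C assms(1) unfolding cover_image_iff by force
      then have "r - 2 \<le> vdeg C (exp_of (\<lambda>k. (r - 2) * Poly_Mapping.lookup (indic (S 1)) k))"
        using member_le_sum[of k C "\<lambda>k. (r - 2) * Poly_Mapping.lookup (indic (S 1)) k"]
        by (simp add: vdeg_def)
      ultimately show ?thesis unfolding vdeg_add by linarith
    qed
    moreover have "psi q m (h_elem r q) = monomial
        (f_exp q S {1..q} + exp_of (\<lambda>k. (r - 2) * Poly_Mapping.lookup (indic (S 1)) k))"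
    proof -
      have "m 1 = monomial (indic (S 1))" using assms(1) by (intro m) simp
      then show ?thesis
        by (simp only: psi_h monom_add monom_power)
    qed
    ultimately show ?thesis
      unfolding I symbolic_power_edge_ideal by (simp only: monom_mem_mon_ideal) blast
  qed
  have "symbolic_power I r \<noteq> ideal_power I r"
    if "r \<ge> 2" "psi q m (h_elem r q) \<notin> ideal_power I r" for r
    using h[OF that(1)] that(2) by metis
  moreover have "symbolic_power I r = ideal_power I r" if "q \<le> 2" for r
  proof -
    have "x \<in> {1..q} \<longleftrightarrow> x \<in> {1, q}" for x
      using that assms(1) by (simp only: atLeastAtMost_iff insert_iff empty_iff) presburger
    then have "{1..q} = {1, q}" by blast
    then have "S ` {1..q} = {S 1, S q}" by simp
    then show ?thesis unfolding I by (simp only: symbolic_power_two_edges)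
  qed
  moreover have "symbolic_power I 2 = ideal_sum (ideal_power I 2) (ideal_gen {psi q m (h_elem 2 3)})"
    if "q = 3"
  proof -
    have "X = {1..q}" if "X \<subseteq> {1..q}" "3 \<le> card X" for X
      using that \<open>q = 3\<close> by (intro card_seteq) auto
    then have "{X. X \<subseteq> {1..q} \<and> 3 \<le> card X} = {{1..q}}" using \<open>q = 3\<close> by auto
    moreover have "psi q m (h_elem 2 3) = monomial (f_exp q S {1..q})"
      using psi_h[of 2] \<open>q = 3\<close> by simp
    ultimately show ?thesis by (simp add: sq ideal_sum_gen ideal_ideal_power[OF idI])
  qed
  moreover have "symbolic_power I 2 = ideal_gen {psi q m (f_elem q X) | X. X \<noteq> {} \<and> X \<subseteq> {1..q}}"
  proof -
    have "{psi q m (f_elem q X) | X. X \<noteq> {} \<and> X \<subseteq> {1..q}} =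
        {monomial (f_exp q S X) | X. X \<noteq> {} \<and> X \<subseteq> {1..q}}"
    proof -
      have "psi q m (f_elem q X) = monomial (f_exp q S X)" if "X \<noteq> {}" "X \<subseteq> {1..q}" for X
        by (rule psi_f_elem[OF _ that]) (rule m)
      then show ?thesis by (intro Collect_cong) metis
    qed
    then show ?thesis unfolding I by (simp only: symbolic_square_exponents)
  qed
  moreover have "sdefect 2 I \<le> enat (2 ^ q - 1 - q - (q choose 2))"
  proof -
    let ?X = "{X. X \<subseteq> {1..q} \<and> 3 \<le> card X}"
    let ?G = "(\<lambda>X. monomial (f_exp q S X) :: ('n, 'k) mpoly) ` ?X"
    have fin: "finite ?X" by (auto intro: finite_subset[of _ "Pow {1..q}"])
    have "sdefect 2 I \<le> enat (card ?G)"
      unfolding sdefect_def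
    proof (rule min_num_generators_quotient_le)
      show "ideal (symbolic_power I 2) cring_class_ops" unfolding sq by (rule ideal_gen_ideal)
      show "ideal_power I 2 \<subseteq> symbolic_power I 2"
        unfolding I by (rule ideal_power_subset_symbolic_power)
    qed (use fin sq ideal_ideal_power[OF idI] in simp_all)
    also have "\<dots> \<le> enat (card ?X)" using card_image_le[OF fin] by simp
    finally show ?thesis by (simp only: card_subsets_ge_3)
  qed
  ultimately show ?thesis by (intro conjI allI impI) simp_all
qed

end
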